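(* Let $\mathcal X$ be an RD-space and let $\rho$ be an admissible function on $\mathcal X$. Let $\{T_t\}_{t>0}$ be a family of bounded linear integral operators on $L^2(\mathcal X)$ with kernels $\{T_t(x,y)\}_{t>0}$, and let $\{\widetilde T_t\}_{t>0}$ be a continuous approximation of the identity of order $(\epsilon_1,\epsilon_2)$ with kernels $\{\widetilde T_t(x,y)\}_{t>0}$, such that for some constants $C_1\in(0,\infty)$, $\epsilon_1\in(0,1]$, $\epsilon_2\in(0,\infty)$, $\delta\in(0,1]$ and $\gamma\in(0,\infty)$ and all $t\in(0,\infty)$ and $x,y\in\mathcal X$, $$|T_t(x,y)-\widetilde T_t(x,y)|\le C_1\left(\frac t{t+\rho(x)}\right)^\delta\frac1{V_t(x)+V(x,y)}\left(\frac t{t+d(x,y)}\right)^\gamma.$$ Define $$P_t(f)=\frac1{\sqrt\pi}\int_0^\infty\frac{e^{-s}}{\sqrt s}T_{t/(2\sqrt s)}(f)\,ds,\qquad \widetilde P_t(f)=\frac1{\sqrt\pi}\int_0^\infty\frac{e^{-s}}{\sqrt s}\widetilde T_{t/(2\sqrt s)}(f)\,ds,$$ and $P^+(f)(x)=\sup_{t>0}|P_t(f)(x)|$, $\widetilde P^+(f)(x)=\sup_{t>0}|\widetilde P_t(f)(x)|$, $\widetilde P^+_\rho(f)(x)=\sup_{0<t<\rho(x)}|\widetilde P_t(f)(x)|$. Then there exists a positive constant $C$ such that for all $f\in\mathrm{BMO}_\rho(\mathcal X)$, $P^+(f),\widetilde P^+(f),\widetilde P^+_\rho(f)\in\mathrm{BLO}_\rho(\mathcal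 X)$ and $$\|P^+(f)\|_{\mathrm{BLO}_\rho(\mathcal X)}+\|\widetilde P^+(f)\|_{\mathrm{BLO}_\rho(\mathcal X)}+\|\widetilde P^+_\rho(f)\|_{\mathrm{BLO}_\rho(\mathcal X)}\le C\|f\|_{\mathrm{BMO}_\rho(\mathcal X)}.$$
   Context: RD-space: $(\mathcal X,d)$ is a metric space with a regular Borel measure $\mu$ such that all balls $B(x,r)=\{y: d(x,y)<r\}$ have finite and positive measure; $\mu$ is doubling, i.e. there is $A_1\ge1$ with $\mu(B(x,2r))\le A_1\mu(B(x,r))$ for all $x\in\mathcal X$, $r>0$; and there are $0<\kappa\le n$, $A_2\in(0,1]$, $A_3\in[1,\infty)$ such that $A_2\lambda^\kappa\mu(B(x,r))\le\mu(B(x,\lambda r))\le A_3\lambda^n\mu(B(x,r))$ for all $x\in\mathcal X$, $0<r\le \mathrm{diam}(\mathcal X)/2$ and $1\le\lambda\le \mathrm{diam}(\mathcal X)/(2r)$. Balls are understood together with their center and radius. Write $V_r(x)=\mu(B(x,r))$ and $V(x,y)=\mu(B(x,d(x,y)))$. Admissible function: $\rho:\mathcal X\to(0,\infty)$ is admissible if there are positive constants $C_0,k_0$ such that $\frac1{\rho(x)}\le C_0\frac1{\rho(y)}\left(1+\frac{d(x,y)}{\rho(y)}\right)^{k_0}$ for all $x,y\in\mathcal X$. Continuous approximation of the identity of order $(\epsilon_1,\epsilon_2)$: a family $\{S_t\}_{t>0}$ of bounded linear integral operators on $L^2(\mathcal X)$ with measurable kernels $S_t(x,y):\mathcal X\times\mathcal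 X\to\mathbb C$ for which there is a positive constant $A_4$ such that for all $t>0$ and $x,x',y\in\mathcal X$: (i) $|S_t(x,y)|\le A_4\frac1{V_t(x)+V_t(y)+V(x,y)}\frac{t^{\epsilon_2}}{(t+d(x,y))^{\epsilon_2}}$; (ii) $|S_t(x,y)-S_t(x',y)|\le A_4\left(\frac{d(x,x')}{t+d(x,y)}\right)^{\epsilon_1}\frac1{V_t(x)+V_t(y)+V(x,y)}\frac{t^{\epsilon_2}}{(t+d(x,y))^{\epsilon_2}}$ whenever $d(x,x')\le(t+d(x,y))/2$; (iii) property (ii) also holds with the roles of $x$ and $y$ interchanged; (iv) $\int_{\mathcal X}S_t(x,z)\,d\mu(z)=1=\int_{\mathcal X}S_t(z,y)\,d\mu(z)$. The operators act on $f\in\mathrm{BMO}_\rho(\mathcal X)$ through their kernels, $T_t(f)(x)=\int_{\mathcal X}T_t(x,y)f(y)\,d\mu(y)$; the kernels $T_t(x,y)$, $\widetilde T_t(x,y)$ are understood to be jointly measurable in $(t,x,y)$ so that the integrals in $s$ make sense. $L^1_{\rm loc}(\mathcal X)$ means integrable on every ball; $f_B=\frac1{\mu(B)}\int_B f\,d\mu$. With $\mathcal D$ the collection of balls $B(x,r)$ with $r\ge\rho(x)$, $\mathrm{BMO}_\rho(\mathcal X)$ and $\mathrm{BLO}_\rho(\mathcal X)$ (the latter consisting of real-valued functions) are the sets of $f\in L^1_{\rm loc}(\mathcal X)$ for which, respectively, the following are finite: $$\|f\|_{\mathrm{BMO}_\rho(\mathcal X)}=\sup_{B\notin\mathcal D}\frac1{\mu(B)}\int_B|f-f_B|\,d\mu+\sup_{B\in\mathcal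 D}\frac1{\mu(B)}\int_B|f|\,d\mu,$$ $$\|f\|_{\mathrm{BLO}_\rho(\mathcal X)}=\sup_{B\notin\mathcal D}\frac1{\mu(B)}\int_B\left[f-\operatorname*{ess\,inf}_B f\right]d\mu+\sup_{B\in\mathcal D}\frac1{\mu(B)}\int_B|f|\,d\mu.$$
   Formalization: The admissible function ρ is additionally assumed to be measurable; without this, the local maximal function over 0<t<ρ(x) can be non-measurable (e.g. Poisson semigroup on R, ρ=1+1_E with E non-measurable), so the claim fails. *)

theory Defs
  imports "HOL-Analysis.Analysis" "HOL-Probability.Essential_Supremum"
begin

(* The metric space is a type of class metric_space, its measure an explicit 'a measure.
   The library's diameter is a real number, unspecified on unbounded sets. *)

definition ediam :: "'a::metric_space set \<Rightarrow> ennreal" where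
  "ediam S = (SUP (x, y) \<in> S \<times> S. ennreal (dist x y))"

(* Only the inclusion of the Borel sets is required, so that a measure on the Borel sets and its
   completion are both covered; regularity is outer regularity. *)
definition regular_borel_measure :: "'a::metric_space measure \<Rightarrow> bool" where
  "regular_borel_measure M \<longleftrightarrow>
     space M = UNIV \<and> sets borel \<subseteq> sets M \<and>
     (\<forall>A\<in>sets M. emeasure M A = (INF U\<in>{U. open U \<and> A \<subseteq> U}. emeasure M U))"

definition vol :: "'a::metric_space measure \<Rightarrow> real \<Rightarrow> 'a \<Rightarrow> real" where
  "vol M r x = measure M (ball x r)"

definition vol2 :: "'a::metric_space measure \<Rightarrow> 'a \<Rightarrow> 'a \<Rightarrow> real" where
  "vol2 M x y = measure M (ball x (dist x y))"

definition RD_space :: "'a::metric_space measure \<Rightarrow> bool" where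
  "RD_space M \<longleftrightarrow>
     regular_borel_measure M \<and>
     (\<forall>x r. r > 0 \<longrightarrow> 0 < emeasure M (ball x r) \<and> emeasure M (ball x r) < \<infinity>) \<and>
     (\<exists>A1\<ge>1. \<forall>x r. r > 0 \<longrightarrow> vol M (2 * r) x \<le> A1 * vol M r x) \<and>
     (\<exists>\<kappa> n A2 A3 :: real. 0 < \<kappa> \<and> \<kappa> \<le> n \<and> 0 < A2 \<and> A2 \<le> 1 \<and> 1 \<le> A3 \<and>
        (\<forall>x r l. 0 < r \<and> ennreal r \<le> ediam (UNIV :: 'a set) / 2 \<and>
                 1 \<le> l \<and> ennreal l \<le> ediam (UNIV :: 'a set) / ennreal (2 * r) \<longrightarrow>
           A2 * l powr \<kappa> * vol M r x \<le> vol M (l * r) x \<and>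
           vol M (l * r) x \<le> A3 * l powr n * vol M r x))"

definition admissible :: "('a::metric_space \<Rightarrow> real) \<Rightarrow> bool" where
  "admissible \<rho> \<longleftrightarrow>
     (\<forall>x. \<rho> x > 0) \<and>
     (\<exists>C0>0. \<exists>k0>0. \<forall>x y. 1 / \<rho> x \<le> C0 * (1 / \<rho> y) * (1 + dist x y / \<rho> y) powr k0)"

definition kernel_op ::
    "'a measure \<Rightarrow> ('a \<Rightarrow> 'a \<Rightarrow> complex) \<Rightarrow> ('a \<Rightarrow> complex) \<Rightarrow> 'a \<Rightarrow> complex" where
  "kernel_op M K f x = (LINT y|M. K x y * f y)"

definition L2 :: "'a measure \<Rightarrow> ('a \<Rightarrow> complex) set" where
  "L2 M = {f. f \<in> borel_measurable M \<and> integrable M (\<lambda>x. (norm (f x))\<^sup>2)}"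

(* Linearity is automatic for an operator given by a kernel. *)
definition bounded_integral_operator :: "'a measure \<Rightarrow> ('a \<Rightarrow> 'a \<Rightarrow> complex) \<Rightarrow> bool" where
  "bounded_integral_operator M K \<longleftrightarrow>
     (\<lambda>(x, y). K x y) \<in> borel_measurable (M \<Otimes>\<^sub>M M) \<and>
     (\<exists>c. \<forall>f\<in>L2 M.
        (AE x in M. integrable M (\<lambda>y. K x y * f y)) \<and>
        kernel_op M K f \<in> L2 M \<and>
        (LINT x|M. (norm (kernel_op M K f x))\<^sup>2) \<le> c * (LINT x|M. (norm (f x))\<^sup>2))"

definition ati_bound :: "'a::metric_space measure \<Rightarrow> real \<Rightarrow> real \<Rightarrow> 'a \<Rightarrow> 'a \<Rightarrow> real" where
  "ati_bound M \<epsilon>2 t x y =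
     1 / (vol M t x + vol M t y + vol2 M x y) * (t powr \<epsilon>2 / (t + dist x y) powr \<epsilon>2)"

definition ati_regular ::
    "'a::metric_space measure \<Rightarrow> real \<Rightarrow> real \<Rightarrow> real \<Rightarrow> real \<Rightarrow> ('a \<Rightarrow> 'a \<Rightarrow> complex) \<Rightarrow> bool" where
  "ati_regular M \<epsilon>1 \<epsilon>2 A t K \<longleftrightarrow>
     (\<forall>x x' y. dist x x' \<le> (t + dist x y) / 2 \<longrightarrow>
        norm (K x y - K x' y) \<le> A * (dist x x' / (t + dist x y)) powr \<epsilon>1 * ati_bound M \<epsilon>2 t x y)"

definition continuous_ati ::
    "'a::metric_space measure \<Rightarrow> real \<Rightarrow> real \<Rightarrow> (real \<Rightarrow> 'a \<Rightarrow> 'a \<Rightarrow> complex) \<Rightarrow> bool" where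
  "continuous_ati M \<epsilon>1 \<epsilon>2 S \<longleftrightarrow>
     (\<forall>t>0. bounded_integral_operator M (S t)) \<and>
     (\<exists>A4>0. \<forall>t>0.
        (\<forall>x y. norm (S t x y) \<le> A4 * ati_bound M \<epsilon>2 t x y) \<and>
        ati_regular M \<epsilon>1 \<epsilon>2 A4 t (S t) \<and>
        ati_regular M \<epsilon>1 \<epsilon>2 A4 t (\<lambda>x y. S t y x)) \<and>
     (\<forall>t>0. \<forall>x. integrable M (\<lambda>z. S t x z) \<and> (LINT z|M. S t x z) = 1) \<and>
     (\<forall>t>0. \<forall>y. integrable M (\<lambda>z. S t z y) \<and> (LINT z|M. S t z y) = 1)"

definition jointly_measurable ::
    "'a measure \<Rightarrow> (real \<Rightarrow> 'a \<Rightarrow> 'a \<Rightarrow> complex) \<Rightarrow> bool" where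
  "jointly_measurable M K \<longleftrightarrow>
     (\<lambda>(t, x, y). K t x y)
       \<in> borel_measurable (restrict_space borel {0<..} \<Otimes>\<^sub>M (M \<Otimes>\<^sub>M M))"

definition L1_loc ::
    "'a::metric_space measure \<Rightarrow> ('a \<Rightarrow> 'b::{banach, second_countable_topology}) set" where
  "L1_loc M = {f. \<forall>x r. r > 0 \<longrightarrow> set_integrable M (ball x r) f}"

definition mean ::
    "'a measure \<Rightarrow> 'a set \<Rightarrow> ('a \<Rightarrow> 'b::{banach, second_countable_topology}) \<Rightarrow> 'b" where
  "mean M B f = (1 / measure M B) *\<^sub>R (LINT y:B|M. f y)"

definition ess_inf_on :: "'a measure \<Rightarrow> 'a set \<Rightarrow> ('a \<Rightarrow> real) \<Rightarrow> ereal" where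
  "ess_inf_on M B f = - esssup (restrict_space M B) (\<lambda>y. - ereal (f y))"

(* A ball is a pair (centre, radius): it belongs to the collection iff its radius is at least
   \<rho> at its centre. Norms take the value \<infinity> outside the spaces. *)

definition sup_large_balls ::
    "'a::metric_space measure \<Rightarrow> ('a \<Rightarrow> real) \<Rightarrow> ('a \<Rightarrow> 'b::real_normed_vector) \<Rightarrow> ennreal" where
  "sup_large_balls M \<rho> f =
     (SUP (x, r) \<in> {(x, r). r > 0 \<and> r \<ge> \<rho> x}.
        (\<integral>\<^sup>+y\<in>ball x r. ennreal (norm (f y)) \<partial>M) / emeasure M (ball x r))"

definition BMO_norm ::
    "'a::metric_space measure \<Rightarrow> ('a \<Rightarrow> real) \<Rightarrow> ('a \<Rightarrow> complex) \<Rightarrow> ennreal" where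
  "BMO_norm M \<rho> f =
     (SUP (x, r) \<in> {(x, r). r > 0 \<and> r < \<rho> x}.
        (\<integral>\<^sup>+y\<in>ball x r. ennreal (norm (f y - mean M (ball x r) f)) \<partial>M) / emeasure M (ball x r))
     + sup_large_balls M \<rho> f"

definition BMO ::
    "'a::metric_space measure \<Rightarrow> ('a \<Rightarrow> real) \<Rightarrow> ('a \<Rightarrow> complex) set" where
  "BMO M \<rho> = {f \<in> L1_loc M. BMO_norm M \<rho> f < \<infinity>}"

(* The integrand is nonnegative almost everywhere on the ball; it is \<infinity> if the essential
   infimum is -\<infinity>. *)
definition BLO_norm ::
    "'a::metric_space measure \<Rightarrow> ('a \<Rightarrow> real) \<Rightarrow> ('a \<Rightarrow> real) \<Rightarrow> ennreal" where
  "BLO_norm M \<rho> f =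
     (SUP (x, r) \<in> {(x, r). r > 0 \<and> r < \<rho> x}.
        (\<integral>\<^sup>+y\<in>ball x r. e2ennreal (ereal (f y) - ess_inf_on M (ball x r) f) \<partial>M)
          / emeasure M (ball x r))
     + sup_large_balls M \<rho> f"

definition BLO ::
    "'a::metric_space measure \<Rightarrow> ('a \<Rightarrow> real) \<Rightarrow> ('a \<Rightarrow> real) set" where
  "BLO M \<rho> = {f \<in> L1_loc M. BLO_norm M \<rho> f < \<infinity>}"

definition subordinated ::
    "'a measure \<Rightarrow> (real \<Rightarrow> 'a \<Rightarrow> 'a \<Rightarrow> complex) \<Rightarrow> real \<Rightarrow> ('a \<Rightarrow> complex) \<Rightarrow> 'a \<Rightarrow> complex" where
  "subordinated M K t f x =
     (1 / sqrt pi) *\<^sub>R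
       (LINT s:{0<..}|lborel. (exp (- s) / sqrt s) *\<^sub>R kernel_op M (K (t / (2 * sqrt s))) f x)"

(* The maximal functions may be \<infinity> on a null set. *)

definition max_fun ::
    "'a measure \<Rightarrow> (real \<Rightarrow> 'a \<Rightarrow> 'a \<Rightarrow> complex) \<Rightarrow> ('a \<Rightarrow> complex) \<Rightarrow> 'a \<Rightarrow> ennreal" where
  "max_fun M K f x = (SUP t\<in>{0<..}. ennreal (norm (subordinated M K t f x)))"

definition local_max_fun ::
    "'a measure \<Rightarrow> ('a \<Rightarrow> real) \<Rightarrow> (real \<Rightarrow> 'a \<Rightarrow> 'a \<Rightarrow> complex) \<Rightarrow> ('a \<Rightarrow> complex) \<Rightarrow> 'a \<Rightarrow> ennreal" where
  "local_max_fun M \<rho> K f x = (SUP t\<in>{0<..<\<rho> x}. ennreal (norm (subordinated M K t f x)))"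

(* Membership and norm of an extended nonnegative function, which has to be finite almost
   everywhere; enn2real only changes it where it is \<infinity>. *)

definition in_BLO :: "'a::metric_space measure \<Rightarrow> ('a \<Rightarrow> real) \<Rightarrow> ('a \<Rightarrow> ennreal) \<Rightarrow> bool" where
  "in_BLO M \<rho> g \<longleftrightarrow> (AE x in M. g x < \<infinity>) \<and> (\<lambda>x. enn2real (g x)) \<in> BLO M \<rho>"

definition ext_BLO_norm :: "'a::metric_space measure \<Rightarrow> ('a \<Rightarrow> real) \<Rightarrow> ('a \<Rightarrow> ennreal) \<Rightarrow> ennreal" where
  "ext_BLO_norm M \<rho> g = BLO_norm M \<rho> (\<lambda>x. enn2real (g x))"

end

theory Submission
  imports Defs
begin

text \<open>
  Write \<open>b\<close> for the norm of \<open>f\<close> and \<open>m x t\<close> for the mean of \<open>f\<close> over \<open>ball x t\<close>. Since \<open>T'\<close> reproduces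
  constants, its size condition alone gives \<open>T'\<^sub>u f x = m x u + O(b)\<close>; the factor
  \<open>(u / (u + \<rho> x)) powr \<delta>\<close> absorbs the logarithmic growth of the means of \<open>f\<close> at scales below
  \<open>\<rho> x\<close>, so \<open>T\<^sub>u f - T'\<^sub>u f = O(b)\<close>. As \<open>m x u - m x t\<close> grows only logarithmically in \<open>u / t\<close>,
  subordination preserves this, and all three maximal functions equal \<open>sup\<^sub>t |m x t| + O(b)\<close>
  pointwise. On a ball \<open>B\<close> of radius \<open>r\<close> the scales
  \<open>t \<ge> r\<close> contribute a constant up to \<open>O(b)\<close>, which bounds the essential infimum from below, and
  the scales \<open>t < r\<close> are controlled by the local maximal function of \<open>f - m z r\<close>, where \<open>z\<close> is the
  centre. Its average over \<open>B\<close> is \<open>O(b)\<close> by a stopping-time argument of John--Nirenberg type: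
  passing to a Vitali family of stopping balls costs \<open>O(b)\<close> and gains a factor \<open>1 / 2\<close> in measure.
\<close>

section \<open>Averages over balls in a doubling space\<close>

text \<open>The iteration on stopping balls replaces the average over one ball by averages over
  smaller balls with new reference means, so it can only close for the supremum over all balls at
  once. That supremum is not known to be finite beforehand. The maximal function is therefore cut
  off at a level \<open>N\<close>; the stopping step respects the cut-off, and the resulting bound
  does not depend on \<open>N\<close>. Measurability is a second obstacle: the maximal functions are
  suprema over uncountably many times, while the kernels are merely measurable in time. The
  substitution s = t^2 r moves the time from the kernel into the exponential; this makes the
  subordinated functions continuous in t, so that rational times suffice. Comparison up to O(b) is
  enough because BLO tolerates bounded measurable perturbations: a function and its essential
  infimum both move by at most the size of the perturbation.\<close>

locale doubling_space =
  fixes M :: "'a::metric_space measure" and A :: real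
  assumes space_M: "space M = UNIV"
    and borel_le: "sets borel \<subseteq> sets M"
    and ball_pos: "r > 0 \<Longrightarrow> 0 < emeasure M (ball x r)"
    and ball_fin: "emeasure M (ball x r) < top"
    and A_ge_1: "1 \<le> A"
    and doubling: "r > 0 \<Longrightarrow> emeasure M (ball x (2 * r)) \<le> ennreal A * emeasure M (ball x r)"
begin

lemma open_sets: "open S \<Longrightarrow> S \<in> sets M"
  using borel_open[of S] borel_le by auto

lemma ball_sets [measurable, simp]: "ball x r \<in> sets M"
  by (simp add: open_sets)

lemma ball_neq: "r > 0 \<Longrightarrow> emeasure M (ball x r) \<noteq> 0" "emeasure M (ball x r) \<noteq> top"
  using ball_pos[of r x] ball_fin[of x r] by auto

lemma emeasure_ball: "emeasure M (ball x r) = ennreal (measure M (ball x r))"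
  by (simp add: emeasure_eq_ennreal_measure ball_neq)

lemma measure_ball_pos: "r > 0 \<Longrightarrow> 0 < measure M (ball x r)"
  using ball_pos[of r x] by (simp add: emeasure_ball)

lemma measure_doubling: "r > 0 \<Longrightarrow> measure M (ball x (2 * r)) \<le> A * measure M (ball x r)"
  using doubling[of r x] A_ge_1 by (simp add: emeasure_ball ennreal_mult'[symmetric])

lemma sigma_finite_M: "sigma_finite_measure M"
proof
  have "(\<Union>n. ball undefined (real n)) = (UNIV :: 'a set)"
    by (auto simp: reals_Archimedean2)
  then show "\<exists>S. countable S \<and> S \<subseteq> sets M \<and> \<Union> S = space M \<and> (\<forall>a\<in>S. emeasure M a \<noteq> \<infinity>)"
    by (intro exI[of _ "range (\<lambda>n. ball undefined (real n))"]) (auto simp: space_M ball_neq)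
qed

text \<open>Valued in \<open>ennreal\<close>, so that averages can be formed and compared before
  anything is known to be integrable or finite.\<close>

definition avg :: "('a \<Rightarrow> ennreal) \<Rightarrow> 'a \<Rightarrow> real \<Rightarrow> ennreal" where
  "avg h x r = (\<integral>\<^sup>+y\<in>ball x r. h y \<partial>M) / emeasure M (ball x r)"

lemma avg_mult: "r > 0 \<Longrightarrow> avg h x r * emeasure M (ball x r) = (\<integral>\<^sup>+y\<in>ball x r. h y \<partial>M)"
  unfolding avg_def using ball_neq(1)[of r x] ball_neq(2)[of x r]
  by (simp only: ennreal_divide_times) (simp add: less_top)

lemma avg_leI:
  "r > 0 \<Longrightarrow> (\<integral>\<^sup>+y\<in>ball x r. h y \<partial>M) \<le> c * emeasure M (ball x r) \<Longrightarrow> avg h x r \<le> c"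
  unfolding avg_def using ball_neq(1)[of r x] ball_neq(2)[of x r] ball_pos[of r x]
  by (intro divide_le_posI_ennreal) (auto simp: mult.commute)

lemma avg_mono: "(\<And>y. dist x y < r \<Longrightarrow> h y \<le> g y) \<Longrightarrow> avg h x r \<le> avg g x r"
  unfolding avg_def
  by (intro divide_right_mono_ennreal nn_integral_mono) (auto simp: indicator_def)

lemma avg_add:
  "h \<in> borel_measurable M \<Longrightarrow> g \<in> borel_measurable M \<Longrightarrow>
    avg (\<lambda>y. h y + g y) x r = avg h x r + avg g x r"
  unfolding avg_def
  by (simp add: distrib_right nn_integral_add add_divide_distrib_ennreal)

lemma avg_cmult:
  "h \<in> borel_measurable M \<Longrightarrow> avg (\<lambda>y. c * h y) x r = c * avg h x r"
  unfolding avg_def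
  by (simp add: mult.assoc nn_integral_cmult ennreal_times_divide)

lemma avg_const: "r > 0 \<Longrightarrow> avg (\<lambda>y. c) x r = c"
  unfolding avg_def using ball_neq(1)[of r x] ball_neq(2)[of x r]
  by (simp only: nn_integral_cmult_indicator[OF ball_sets] ennreal_times_divide[symmetric])
     (simp add: less_top)

lemma avg_subset:
  assumes "r > 0" "s > 0" "ball x r \<subseteq> ball z s"
    and "emeasure M (ball z s) \<le> c * emeasure M (ball x r)"
  shows "avg h x r \<le> c * avg h z s"
proof (rule avg_leI[OF assms(1)])
  have "(\<integral>\<^sup>+y\<in>ball x r. h y \<partial>M) \<le> (\<integral>\<^sup>+y\<in>ball z s. h y \<partial>M)"
    using assms(3) by (intro nn_integral_mono) (auto simp: indicator_def)
  also have "\<dots> = avg h z s * emeasure M (ball z s)"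
    using avg_mult[OF assms(2)] by simp
  also have "\<dots> \<le> avg h z s * (c * emeasure M (ball x r))"
    by (intro mult_left_mono assms(4)) simp
  finally show "(\<integral>\<^sup>+y\<in>ball x r. h y \<partial>M) \<le> c * avg h z s * emeasure M (ball x r)"
    by (simp add: ac_simps)
qed

lemma avg_double: 
  assumes "0 < r" "r \<le> s" "s \<le> 2 * r"
  shows "avg h x r \<le> ennreal A * avg h x s"
proof (rule avg_subset)
  have "emeasure M (ball x s) \<le> emeasure M (ball x (2 * r))"
    using assms by (intro emeasure_mono) auto
  also note doubling[OF assms(1)]
  finally show "emeasure M (ball x s) \<le> ennreal A * emeasure M (ball x r)" .
qed (use assms in auto)

lemma avg_shift:
  assumes "0 < s" "dist x z \<le> s"
  shows "avg h x s \<le> ennreal (A\<^sup>2) * avg h z (2 * s)"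
proof (rule avg_subset)
  show "ball x s \<subseteq> ball z (2 * s)" 
  proof
    fix y assume "y \<in> ball x s"
    then show "y \<in> ball z (2 * s)"
      using assms dist_triangle[of z y x] by (auto simp: dist_commute)
  qed
  have "ball z (2 * s) \<subseteq> ball x (2 * (2 * s))"
  proof
    fix y assume "y \<in> ball z (2 * s)"
    then show "y \<in> ball x (2 * (2 * s))"
      using assms dist_triangle[of x y z] by (auto simp: dist_commute)
  qed
  then have "emeasure M (ball z (2 * s)) \<le> emeasure M (ball x (2 * (2 * s)))"
    by (intro emeasure_mono) auto
  also have "\<dots> \<le> ennreal A * emeasure M (ball x (2 * s))"
    using assms by (intro doubling) auto
  also have "\<dots> \<le> ennreal A * (ennreal A * emeasure M (ball x s))"
    using assms by (intro mult_left_mono doubling) auto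
  also have "\<dots> = ennreal (A\<^sup>2) * emeasure M (ball x s)"
    using A_ge_1 by (simp add: power2_eq_square ennreal_mult mult.assoc)
  finally show "emeasure M (ball z (2 * s)) \<le> ennreal (A\<^sup>2) * emeasure M (ball x s)" .
qed (use assms in auto)

text \<open>The integral over an open ball is lower semicontinuous in the centre. By monotone
  convergence a slightly smaller ball already has integral above \<open>c\<close>, and that smaller
  ball lies in \<open>ball y r\<close> for all y near x.\<close>

lemma ball_integral_measurable:
  assumes [measurable]: "h \<in> borel_measurable M"
  shows "(\<lambda>x. \<integral>\<^sup>+y\<in>ball x r. h y \<partial>M) \<in> borel_measurable M"
proof (rule borel_measurableI_greater)
  fix c :: ennreal
  let ?S = "{x. c < (\<integral>\<^sup>+y\<in>ball x r. h y \<partial>M)}"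
  have "open ?S"
    unfolding open_dist
  proof (intro ballI)
    fix x assume "x \<in> ?S"
    then have c: "c < (\<integral>\<^sup>+y\<in>ball x r. h y \<partial>M)" by simp
    have "(\<lambda>n. \<integral>\<^sup>+y\<in>ball x (r - 1 / Suc n). h y \<partial>M) \<longlonglongrightarrow> (\<integral>\<^sup>+y\<in>ball x r. h y \<partial>M)"
    proof (rule nn_integral_LIMSEQ)
      show "incseq (\<lambda>n y. h y * indicator (ball x (r - 1 / Suc n)) y)"
      proof (rule incseq_SucI, rule le_funI)
        fix n y
        have "1 / real (Suc (Suc n)) \<le> 1 / real (Suc n)"
          by (intro divide_left_mono) auto
        then show "h y * indicator (ball x (r - 1 / Suc n)) y
            \<le> h y * indicator (ball x (r - 1 / Suc (Suc n))) y"
          by (auto simp: indicator_def)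
      qed
      fix y
      show "(\<lambda>n. h y * indicator (ball x (r - 1 / Suc n)) y) \<longlonglongrightarrow> h y * indicator (ball x r) y"
      proof (cases "dist x y < r")
        case True
        then obtain N where N: "1 / real (Suc N) < r - dist x y"
          using nat_approx_posE[of "r - dist x y"] by auto
        have "h y * indicator (ball x (r - 1 / Suc n)) y = h y * indicator (ball x r) y"
          if "n \<ge> N" for n
        proof -
          have "1 / real (Suc n) \<le> 1 / real (Suc N)"
            using that by (intro divide_left_mono) auto
          then show ?thesis using N True by (auto simp: indicator_def)
        qed
        then show ?thesis
          by (intro tendsto_eventually) (auto simp: eventually_sequentially)
      next
        case False
        have "h y * indicator (ball x (r - 1 / Suc n)) y = 0" for n
        proof -
          have "0 < 1 / real (Suc n)" by simp
          then have "\<not> dist x y < r - 1 / real (Suc n)" using False by linarith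
          then show ?thesis by (simp add: indicator_def)
        qed
        then have "(\<lambda>n. h y * indicator (ball x (r - 1 / Suc n)) y) = (\<lambda>n. 0)" by blast
        then show ?thesis using False by (simp only:) simp
      qed
    qed auto
    from order_tendstoD(1)[OF this c] obtain n
      where n: "c < (\<integral>\<^sup>+y\<in>ball x (r - 1 / Suc n). h y \<partial>M)"
      by (auto simp: eventually_sequentially)
    have "y \<in> ?S" if "dist y x < 1 / Suc n" for y
    proof -
      have "ball x (r - 1 / Suc n) \<subseteq> ball y r"
      proof
        fix z assume "z \<in> ball x (r - 1 / Suc n)"
        then show "z \<in> ball y r"
          using that dist_triangle[of y z x] by auto
      qed
      then have "(\<integral>\<^sup>+y\<in>ball x (r - 1 / Suc n). h y \<partial>M) \<le> (\<integral>\<^sup>+y\<in>ball y r. h y \<partial>M)"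
        by (intro nn_integral_mono) (auto simp: indicator_def)
      then show ?thesis using n by simp
    qed
    then show "\<exists>e>0. \<forall>y. dist y x < e \<longrightarrow> y \<in> ?S"
      by (intro exI[of _ "1 / Suc n"]) auto
  qed
  then show "{x \<in> space M. c < (\<integral>\<^sup>+y\<in>ball x r. h y \<partial>M)} \<in> sets M"
    by (simp add: space_M open_sets)
qed

lemma avg_measurable [measurable]:
  assumes [measurable]: "h \<in> borel_measurable M"
  shows "(\<lambda>x. avg h x r) \<in> borel_measurable M"
proof -
  have "(\<lambda>x. emeasure M (ball x r)) = (\<lambda>x. \<integral>\<^sup>+y\<in>ball x r. 1 \<partial>M)"
    by simp
  also have "\<dots> \<in> borel_measurable M"
    by (rule ball_integral_measurable) simp
  finally have [measurable]: "(\<lambda>x. emeasure M (ball x r)) \<in> borel_measurable M" .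
  show ?thesis
    unfolding avg_def using ball_integral_measurable[OF assms] by measurable
qed

lemma L1_loc_measurable:
  fixes f :: "'a \<Rightarrow> 'b::{banach, second_countable_topology}"
  assumes "f \<in> L1_loc M"
  shows "f \<in> borel_measurable M"
proof (rule borel_measurable_LIMSEQ_metric)
  let ?B = "\<lambda>n. ball undefined (real (Suc n)) :: 'a set"
  show "(\<lambda>x. indicator (?B n) x *\<^sub>R f x) \<in> borel_measurable M" for n
  proof -
    have "set_integrable M (?B n) f"
      using assms by (auto simp: L1_loc_def)
    then show ?thesis
      unfolding set_integrable_def by (rule borel_measurable_integrable)
  qed
  fix x :: 'a
  obtain N where N: "dist undefined x < real N"
    using reals_Archimedean2 by blast
  have "indicator (?B n) x *\<^sub>R f x = f x" if "n \<ge> N" for n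
    using N that by (auto simp: indicator_def)
  then show "(\<lambda>n. indicator (?B n) x *\<^sub>R f x) \<longlonglongrightarrow> f x"
    by (intro tendsto_eventually) (auto simp: eventually_sequentially)
qed

lemma norm_mean_diff_le:
  fixes f :: "'a \<Rightarrow> complex"
  assumes f: "f \<in> L1_loc M" and r: "r > 0"
  shows "ennreal (norm (mean M (ball x r) f - c)) \<le> avg (\<lambda>y. ennreal (norm (f y - c))) x r"
proof -
  let ?B = "ball x r" and ?m = "measure M (ball x r)"
  have m: "?m > 0" by (rule measure_ball_pos[OF r])
  have fi: "set_integrable M ?B f" using f r by (auto simp: L1_loc_def)
  have ci: "set_integrable M ?B (\<lambda>_. c)"
    unfolding set_integrable_def using ball_fin
    by (intro integrable_scaleR_left integrable_real_indicator) auto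
  have "(LINT y:?B|M. c) = ?m *\<^sub>R c"
    unfolding set_lebesgue_integral_def
    by (subst integral_scaleR_left) (use ball_fin in auto)
  then have "mean M ?B f - c = (1 / ?m) *\<^sub>R ((LINT y:?B|M. f y) - (LINT y:?B|M. c))"
    using m by (simp add: mean_def scaleR_diff_right)
  also have "\<dots> = (1 / ?m) *\<^sub>R (LINT y:?B|M. f y - c)"
    by (subst set_integral_diff(2)[OF fi ci]) simp
  finally have "ennreal (norm (mean M ?B f - c)) = ennreal (norm (LINT y:?B|M. f y - c) / ?m)"
    using m by simp
  also have "\<dots> = ennreal (norm (LINT y:?B|M. f y - c)) / emeasure M ?B"
    using m by (simp add: emeasure_ball divide_ennreal)
  also have "\<dots> \<le> (\<integral>\<^sup>+y. ennreal (norm (indicator ?B y *\<^sub>R (f y - c))) \<partial>M) / emeasure M ?B"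
    unfolding set_lebesgue_integral_def
    using set_integral_diff(1)[OF fi ci] unfolding set_integrable_def
    by (intro divide_right_mono_ennreal integral_norm_bound_ennreal)
  also have "\<dots> = avg (\<lambda>y. ennreal (norm (f y - c))) x r"
    unfolding avg_def
    by (intro arg_cong2[where f="(/)"] nn_integral_cong) (auto simp: indicator_def)
  finally show ?thesis .
qed

end

text \<open>Greedy selection along a well-order that lists the larger balls first.\<close>
lemma vitali_dyadic:
  fixes s :: "'a::metric_space \<Rightarrow> real" and j :: "'a \<Rightarrow> nat"
  assumes s: "\<And>x. x \<in> E \<Longrightarrow> s x = R / 2 ^ j x" and R: "R > 0"
  obtains I where "I \<subseteq> E"
    "\<And>x y. x \<in> I \<Longrightarrow> y \<in> I \<Longrightarrow> x \<noteq> y \<Longrightarrow> ball x (s x) \<inter> ball y (s y) = {}"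
    "\<And>x. x \<in> E \<Longrightarrow> \<exists>y\<in>I. s x \<le> s y \<and> dist y x < 2 * s y"
proof -
  obtain W :: "'a rel" where W: "well_order_on UNIV W"
    using well_order_on[of UNIV] by blast
  define W' where "W' = inv_image (less_than <*lex*> (W - Id)) (\<lambda>x. (j x, x))"
  have wfW': "wf W'"
    unfolding W'_def using W by (intro wf_inv_image wf_lex_prod wf_less_than) (simp add: well_order_on_def)
  define sel where "sel = wfrec W' (\<lambda>g x. x \<in> E \<and> (\<forall>y. (y, x) \<in> W' \<longrightarrow> g y \<longrightarrow> ball y (s y) \<inter> ball x (s x) = {}))"
  have sel: "sel x \<longleftrightarrow> x \<in> E \<and> (\<forall>y. (y, x) \<in> W' \<longrightarrow> sel y \<longrightarrow> ball y (s y) \<inter> ball x (s x) = {})" for x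
    unfolding sel_def
    by (subst wfrec[OF wfW']) (auto simp: cut_def)
  have total: "(x, y) \<in> W' \<or> (y, x) \<in> W'" if "x \<noteq> y" for x y
    using W that unfolding W'_def well_order_on_def linear_order_on_def total_on_def
    by auto
  show thesis
  proof
    show "Collect sel \<subseteq> E" using sel by auto
    show "ball x (s x) \<inter> ball y (s y) = {}" if "x \<in> Collect sel" "y \<in> Collect sel" "x \<noteq> y" for x y
      using total[OF that(3)] that sel[of x] sel[of y] by blast
    fix x assume x: "x \<in> E"
    then have sx: "s x > 0" using s R by simp
    show "\<exists>y\<in>Collect sel. s x \<le> s y \<and> dist y x < 2 * s y"
    proof (cases "sel x")
      case True
      then show ?thesis using sx by (intro bexI[of _ x]) auto
    next
      case False
      then obtain y where y: "(y, x) \<in> W'" "sel y" "ball y (s y) \<inter> ball x (s x) \<noteq> {}"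
        using sel[of x] x by auto
      have "j y \<le> j x" using y(1) by (auto simp: W'_def)
      then have "s x \<le> s y"
        using s[OF x] s[of y] sel[of y] y(2) R
        by (auto intro!: divide_left_mono power_increasing)
      \<comment> \<open>Only the centre x has to be covered, whence the factor 2 instead of the 3
        needed to cover all of \<open>ball x (s x)\<close>; a single doubling will pay for
        it.\<close>
      moreover obtain z where "dist y z < s y" "dist x z < s x" using y(3) by auto
      then have "dist y x < s y + s x"
        using dist_triangle[of y x z] by (simp add: dist_commute)
      ultimately show ?thesis using y(2) by (intro bexI[of _ y]) auto
    qed
  qed
qed

section \<open>Oscillation and a local maximal function\<close>

text \<open>Trades a number of dyadic steps for an arbitrarily small power of the ratio of scales.
  The constant is chosen so that C \<theta> ln 2 is at least 1; the rest is 1 + x \<le> exp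
  x.\<close>

lemma Suc_le_powr:
  fixes \<theta> :: real
  assumes "\<theta> > 0"
  obtains C where "C \<ge> 1" "\<And>k::nat. real (Suc k) \<le> C * 2 powr (\<theta> * real k)"
proof -
  define C where "C = max 1 (1 / (\<theta> * ln 2))"
  have C: "C \<ge> 1" "C * (\<theta> * ln 2) \<ge> 1"
    using assms by (auto simp: C_def max_def field_simps)
  show thesis
  proof
    show "C \<ge> 1" by fact
    fix k :: nat
    have "real (Suc k) \<le> C + C * (\<theta> * ln 2) * real k"
      using C mult_right_mono[of 1 "C * (\<theta> * ln 2)" "real k"] by simp
    also have "\<dots> = C * (1 + \<theta> * real k * ln 2)" by (simp add: algebra_simps)
    also have "\<dots> \<le> C * exp (\<theta> * real k * ln 2)"
      using C by (intro mult_left_mono exp_ge_add_one_self) auto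
    finally show "real (Suc k) \<le> C * 2 powr (\<theta> * real k)" by (simp add: powr_def)
  qed
qed

lemma ennreal_half: "ennreal (1 / 2) = 1 / 2"
  by (metis ennreal_1 ennreal_divide_numeral zero_le_one)

lemma dyadic_between:
  fixes s t :: real
  assumes "0 < s" "s \<le> t"
  obtains k :: nat where "2 ^ k * s \<le> t" "t < 2 * (2 ^ k * s)"
proof -
  obtain n where "t / s < 2 ^ n"
    using real_arch_pow[of 2 "t / s"] by auto
  define m where "m = (LEAST n. t / s < 2 ^ n)"
  have m: "t / s < 2 ^ m" unfolding m_def by (rule LeastI) fact
  have "m \<noteq> 0" using m assms by (intro notI) (simp add: field_simps)
  then obtain k where k: "m = Suc k" using not0_implies_Suc by blast
  then have "\<not> t / s < 2 ^ k" using not_less_Least[of k "\<lambda>n. t / s < 2 ^ n"] by (simp add: m_def)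
  then show thesis using m k assms by (intro that[of k]) (auto simp: field_simps not_less)
qed

text \<open>The Vitali family comes without an enumeration, so sums over it are integrals over
  \<open>count_space I\<close>; countability makes this measure sigma-finite, which gives
  measurability in x.\<close>

lemma measurable_nn_integral_count_space:
  fixes F :: "'i \<Rightarrow> 'a \<Rightarrow> ennreal"
  assumes I: "countable I" and F: "\<And>i. i \<in> I \<Longrightarrow> F i \<in> borel_measurable M"
  shows "(\<lambda>x. \<integral>\<^sup>+i. F i x \<partial>count_space I) \<in> borel_measurable M"
proof -
  have "(\<lambda>z. F (snd z) (fst z)) \<in> borel_measurable (M \<Otimes>\<^sub>M count_space I)"
  proof (rule measurable_compose_countable'[where f = "\<lambda>i z. F i (fst z)" and g = snd and I = I])
    show "(\<lambda>z. F i (fst z)) \<in> borel_measurable (M \<Otimes>\<^sub>M count_space I)" if "i \<in> I" for i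
      by (rule measurable_compose[OF measurable_fst F[OF that]])
  qed (rule measurable_snd, rule I)
  then show ?thesis
    by (intro sigma_finite_measure.borel_measurable_nn_integral
      sigma_finite_measure_count_space_countable I) (simp add: case_prod_beta')
qed

text \<open>Oscillation is bounded at every radius, which allows means to be chained across all
  scales. \<open>b\<close> is any positive bound instead of the norm, so that the threshold
  \<open>L\<close> built from it can be cancelled even if the norm is 0.\<close>

locale bmo = doubling_space M A for M :: "'a::metric_space measure" and A +
  fixes f :: "'a \<Rightarrow> complex" and b :: real
  assumes f_loc: "f \<in> L1_loc M"
    and b_pos: "0 < b"
    and osc: "r > 0 \<Longrightarrow> avg (\<lambda>y. ennreal (norm (f y - mean M (ball x r) f))) x r \<le> ennreal b"
begin

lemma f_meas [measurable]: "f \<in> borel_measurable M"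
  using f_loc by (rule L1_loc_measurable)

abbreviation m :: "'a \<Rightarrow> real \<Rightarrow> complex" where
  "m x r \<equiv> mean M (ball x r) f"

abbreviation dev :: "complex \<Rightarrow> 'a \<Rightarrow> ennreal" where
  "dev c \<equiv> \<lambda>y. ennreal (norm (f y - c))"

section \<open>Growth of the means of f between scales and centres\<close>

lemma avg_dev_change:
  assumes "r > 0"
  shows "avg (dev c) x r \<le> avg (dev c') x r + ennreal (norm (c' - c))"
proof -
  have "avg (dev c) x r \<le> avg (\<lambda>y. dev c' y + ennreal (norm (c' - c))) x r"
    by (intro avg_mono) (simp flip: ennreal_plus, metis norm_diff_triangle_ineq norm_triangle_ineq diff_add_cancel add_diff_eq)
  also have "\<dots> = avg (dev c') x r + ennreal (norm (c' - c))"
    using assms by (subst avg_add) (auto simp: avg_const)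
  finally show ?thesis .
qed

lemma mean_double:
  assumes "0 < r" "r \<le> s" "s \<le> 2 * r"
  shows "norm (m x r - m x s) \<le> A * b"
proof -
  have "ennreal (norm (m x r - m x s)) \<le> avg (dev (m x s)) x r"
    using norm_mean_diff_le[OF f_loc] assms by auto
  also have "\<dots> \<le> ennreal A * avg (dev (m x s)) x s"
    using avg_double assms by blast
  also have "\<dots> \<le> ennreal A * ennreal b"
    using assms by (intro mult_left_mono osc) auto
  finally show ?thesis using A_ge_1 b_pos by (simp flip: ennreal_mult)
qed

lemma mean_pow2:
  assumes "0 < r"
  shows "norm (m x r - m x (2 ^ k * r)) \<le> real k * (A * b)"
proof (induction k)
  case 0
  then show ?case by simp
next
  case (Suc k)
  have "norm (m x (2 ^ k * r) - m x (2 ^ Suc k * r)) \<le> A * b"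
    using assms by (intro mean_double) auto
  then show ?case
    using Suc norm_triangle_ineq[of "m x r - m x (2 ^ k * r)" "m x (2 ^ k * r) - m x (2 ^ Suc k * r)"]
    by (simp add: algebra_simps)
qed

lemma mean_steps:
  assumes "0 < s" "s \<le> t" "2 ^ k * s \<le> t" "t < 2 * (2 ^ k * s)"
  shows "norm (m x s - m x t) \<le> real (Suc k) * (A * b)"
proof -
  have "norm (m x (2 ^ k * s) - m x t) \<le> A * b"
    using assms by (intro mean_double) auto
  then show ?thesis
    using mean_pow2[OF assms(1), of x k]
      norm_triangle_ineq[of "m x s - m x (2 ^ k * s)" "m x (2 ^ k * s) - m x t"]
    by (simp add: algebra_simps)
qed

text \<open>The exponent is left to the caller: \<delta> for the perturbation of the kernels, 1/2
  for subordination.\<close>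

lemma mean_powr:
  assumes C: "\<And>k::nat. real (Suc k) \<le> C * 2 powr (\<theta> * real k)" and "\<theta> > 0" and st: "0 < s" "s \<le> t"
  shows "norm (m x s - m x t) \<le> C * (A * b) * (t / s) powr \<theta>"
proof -
  have C0: "C \<ge> 0" using C[of 0] by simp
  obtain k where k: "2 ^ k * s \<le> t" "t < 2 * (2 ^ k * s)"
    using dyadic_between[OF st] by blast
  have "real (Suc k) \<le> C * 2 powr (\<theta> * real k)" by (rule C)
  also have "2 powr (\<theta> * real k) = (2 ^ k) powr \<theta>"
    by (simp add: powr_powr mult.commute flip: powr_realpow)
  also have "C * (2 ^ k) powr \<theta> \<le> C * (t / s) powr \<theta>"
    using k st assms(2) C0 by (intro mult_left_mono powr_mono2) (auto simp: field_simps)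
  finally have "real (Suc k) * (A * b) \<le> C * (t / s) powr \<theta> * (A * b)"
    using A_ge_1 b_pos by (intro mult_right_mono) auto
  then show ?thesis using mean_steps[OF st k, of x] by (simp add: ac_simps)
qed

text \<open>Both means are compared with the one over \<open>ball z (2 * s)\<close>, which contains
  both balls.\<close>

lemma mean_shift:
  assumes "0 < s" "dist x z \<le> s"
  shows "norm (m x s - m z s) \<le> 2 * A\<^sup>2 * b"
proof -
  have "ennreal (norm (m x s - m z (2 * s))) \<le> avg (dev (m z (2 * s))) x s"
    using norm_mean_diff_le[OF f_loc] assms by auto
  also have "\<dots> \<le> ennreal (A\<^sup>2) * avg (dev (m z (2 * s))) z (2 * s)"
    using avg_shift assms by blast
  also have "\<dots> \<le> ennreal (A\<^sup>2) * ennreal b"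
    using assms by (intro mult_left_mono osc) auto
  finally have "norm (m x s - m z (2 * s)) \<le> A\<^sup>2 * b"
    using A_ge_1 b_pos by (simp flip: ennreal_mult)
  moreover have "norm (m z s - m z (2 * s)) \<le> A * b"
    using assms by (intro mean_double) auto
  moreover have "A * b \<le> A\<^sup>2 * b"
    using A_ge_1 b_pos by (simp add: power2_eq_square)
  ultimately show ?thesis
    using norm_triangle_ineq4[of "m x s - m z (2 * s)" "m z s - m z (2 * s)"] by simp
qed

text \<open>The growth is linear in the number of doublings, slow enough to be summed against the
  geometric decay of a kernel.\<close>

lemma avg_dev_pow2:
  assumes "0 < r"
  shows "avg (dev (m x r)) x (2 ^ k * r) \<le> ennreal (real (Suc k) * (A * b))"
proof -
  have "avg (dev (m x r)) x (2 ^ k * r)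
      \<le> avg (dev (m x (2 ^ k * r))) x (2 ^ k * r) + ennreal (norm (m x (2 ^ k * r) - m x r))"
    using assms by (intro avg_dev_change) auto
  also have "\<dots> \<le> ennreal b + ennreal (real k * (A * b))"
    using assms mean_pow2[OF assms, of x k]
    by (intro add_mono osc ennreal_leI) (auto simp: norm_minus_commute)
  also have "\<dots> = ennreal (b + real k * (A * b))"
    using A_ge_1 b_pos by simp
  also have "\<dots> \<le> ennreal (real (Suc k) * (A * b))"
    using A_ge_1 b_pos by (intro ennreal_leI) (simp add: algebra_simps)
  finally show ?thesis .
qed

text \<open>Restricting to the radii \<open>R / 2 ^ j\<close> makes the supremum countable, hence
  measurable, and gives every point a first stopping scale; by \<open>avg_le_loc_max\<close> all
  other radii up to \<open>R\<close> cost only a factor \<open>A\<close>.\<close>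

definition loc_max :: "'a \<Rightarrow> real \<Rightarrow> 'a \<Rightarrow> ennreal" where
  "loc_max z R x = (SUP j::nat. avg (dev (m z R)) x (R / 2 ^ j))"

lemma loc_max_measurable [measurable]: "loc_max z R \<in> borel_measurable M"
  unfolding loc_max_def by measurable

lemma avg_le_loc_max:
  assumes "0 < t" "t \<le> R"
  shows "avg (dev (m z R)) x t \<le> ennreal A * loc_max z R x"
proof -
  obtain k where k: "2 ^ k * t \<le> R" "R < 2 * (2 ^ k * t)"
    using dyadic_between[OF assms] by blast
  have "avg (dev (m z R)) x t \<le> ennreal A * avg (dev (m z R)) x (R / 2 ^ k)"
    using k assms by (intro avg_double) (auto simp: field_simps)
  also have "\<dots> \<le> ennreal A * loc_max z R x"
    unfolding loc_max_def by (intro mult_left_mono SUP_upper) auto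
  finally show ?thesis .
qed

text \<open>The stopping threshold. At scale \<open>R\<close> the averages are at most 2 A^3 b, so
  no point of the ball stops at once. The stopping balls have total measure at most 2 A^2 b / L
  times that of the ball; doubling their radii costs a factor \<open>A\<close>, and 2 A^3 b / L =
  1/2.\<close>

abbreviation L :: real where "L \<equiv> 4 * A ^ 3 * b"

lemma L_pos: "0 < L" using A_ge_1 b_pos by simp

lemma avg_dev_start:
  assumes "0 < R" "dist z x < R"
  shows "avg (dev (m z R)) x R \<le> ennreal L"
proof -
  have "avg (dev (m z R)) x R \<le> ennreal (A\<^sup>2) * avg (dev (m z R)) z (2 * R)"
    using assms by (intro avg_shift) (auto simp: dist_commute)
  also have "avg (dev (m z R)) z (2 * R) \<le> ennreal (2 * (A * b))"
    using avg_dev_pow2[OF assms(1), of z 1] by simp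
  also have "ennreal (A\<^sup>2) * ennreal (2 * (A * b)) \<le> ennreal L"
    using A_ge_1 b_pos by (subst ennreal_mult[symmetric]) (auto intro!: ennreal_leI simp: power2_eq_square power3_eq_cube)
  finally show ?thesis by (simp add: mult_left_mono)
qed

text \<open>The measures of the balls are positive and their finite sums are bounded by the measure
  of the enclosing ball; a summable family has countable support.\<close>

lemma countable_disjoint_balls:
  fixes I :: "'a set" and s :: "'a \<Rightarrow> real"
  assumes disj: "\<And>x y. x \<in> I \<Longrightarrow> y \<in> I \<Longrightarrow> x \<noteq> y \<Longrightarrow> ball x (s x) \<inter> ball y (s y) = {}"
    and sub: "\<And>x. x \<in> I \<Longrightarrow> ball x (s x) \<subseteq> ball z R" and pos: "\<And>x. x \<in> I \<Longrightarrow> s x > 0"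
  shows "countable I"
proof -
  have "(\<lambda>x. measure M (ball x (s x))) summable_on I"
  proof (rule nonneg_bounded_partial_sums_imp_summable_on)
    show "\<forall>\<^sub>F F in finite_subsets_at_top I. (\<Sum>x\<in>F. measure M (ball x (s x))) \<le> measure M (ball z R)"
    proof (rule eventually_finite_subsets_at_top_weakI)
      fix F assume F: "finite F" "F \<subseteq> I"
      have "(\<Sum>x\<in>F. measure M (ball x (s x))) = measure M (\<Union>x\<in>F. ball x (s x))"
        using F disj ball_fin
        by (intro measure_finite_Union[symmetric])
           (auto simp: disjoint_family_on_def subset_iff ball_neq)
      also have "\<dots> \<le> measure M (ball z R)"
        using F sub by (intro measure_mono_fmeasurable) (auto simp: fmeasurable_def ball_fin subset_iff)
      finally show "(\<Sum>x\<in>F. measure M (ball x (s x))) \<le> measure M (ball z R)" .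
    qed
  qed auto
  then have "countable {x\<in>I. measure M (ball x (s x)) \<noteq> 0}"
    by (rule summable_countable_real)
  also have "{x\<in>I. measure M (ball x (s x)) \<noteq> 0} = I"
    using measure_ball_pos[OF pos] by (auto simp: order.strict_iff_order)
  finally show ?thesis .
qed


text \<open>Off the set \<open>E\<close> of stopping points every dyadic average is at most
  \<open>L\<close>. A point of \<open>E\<close> lies in the double of a selected ball; its averages
  before stopping are at most \<open>L\<close>, and those afterwards are at most \<open>L\<close>
  plus the local maximal function of that double, the reference mean being exchanged. Since
  \<open>a\<close> bounds the averages for all balls, it also bounds those for the doubles, which
  have at most half the measure of the ball.\<close>

lemma loc_max_truncated_step:
  fixes N :: ennreal
  assumes R: "R > 0"
    and a: "\<And>z R. R > 0 \<Longrightarrow> avg (\<lambda>x. min (loc_max z R x) N) z R \<le> a"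
  shows "avg (\<lambda>x. min (loc_max z R x) N) z R \<le> ennreal L + a * (1 / 2)"
proof (rule avg_leI[OF R])
  define c where "c = m z R"
  define P where "P x j \<longleftrightarrow> avg (dev c) x (R / 2 ^ j) > ennreal L" for x and j :: nat
  define E where "E = {x \<in> ball z R. \<exists>j. P x j}"
  define J where "J x = (LEAST j. P x j)" for x
  define s where "s x = R / 2 ^ J x" for x
  have PJ: "P x (J x)" if "x \<in> E" for x
    using that unfolding E_def J_def by (auto intro: LeastI)
  have nP: "\<not> P x j" if "j < J x" for x j
    using that unfolding J_def by (rule not_less_Least)
  have P0: "\<not> P x 0" if "x \<in> ball z R" for x
    using avg_dev_start[OF R, of z x] that by (simp add: P_def c_def not_less)
  have J0: "J x > 0" if "x \<in> E" for x
    using PJ[OF that] P0[of x] that by (cases "J x") (auto simp: E_def)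
  \<comment> \<open>The double of a stopping ball has the last dyadic radius before stopping, so the
    average over it is still at most \<open>L\<close>; this is what makes the exchange of reference
    means cheap.\<close>
  have s2: "2 * s x = R / 2 ^ (J x - 1)" if "x \<in> E" for x
    using J0[OF that] unfolding s_def by (cases "J x") auto
  have s_pos: "s x > 0" for x using R by (simp add: s_def)
  have s_R: "2 * s x \<le> R" if "x \<in> E" for x
    unfolding s2[OF that] using R by (simp add: field_simps)
  obtain I where I: "I \<subseteq> E"
    and disj: "\<And>x y. x \<in> I \<Longrightarrow> y \<in> I \<Longrightarrow> x \<noteq> y \<Longrightarrow> ball x (s x) \<inter> ball y (s y) = {}"
    and cover: "\<And>x. x \<in> E \<Longrightarrow> \<exists>y\<in>I. s x \<le> s y \<and> dist y x < 2 * s y"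
    using vitali_dyadic[of E s R J] s_def R by blast
  have sub: "ball x (s x) \<subseteq> ball z (2 * R)" if "x \<in> I" for x
  proof
    fix y assume "y \<in> ball x (s x)"
    moreover have "x \<in> E" using that I by auto
    moreover have "dist z x < R" using \<open>x \<in> E\<close> by (simp add: E_def)
    ultimately show "y \<in> ball z (2 * R)"
      using s_R[of x] s_pos[of x] dist_triangle[of z y x] by auto
  qed
  have cI: "countable I"
    using countable_disjoint_balls[OF disj sub s_pos] by blast
  let ?F = "\<lambda>i x. min (loc_max i (2 * s i) x) N * indicator (ball i (2 * s i)) x"
  have point: "min (loc_max z R x) N \<le> ennreal L + (\<integral>\<^sup>+i. ?F i x \<partial>count_space I)"
    if x: "x \<in> ball z R" for x
  proof (cases "x \<in> E")
    case False
    then have "loc_max z R x \<le> ennreal L"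
      unfolding loc_max_def using x by (intro SUP_least) (auto simp: E_def P_def c_def not_less)
    then show ?thesis by (meson add_increasing2 min.coboundedI1 zero_le)
  next
    case True
    obtain y where y: "y \<in> I" "s x \<le> s y" "dist y x < 2 * s y"
      using cover[OF True] by blast
    then have yE: "y \<in> E" using I by auto
    have Jyx: "J y \<le> J x"
    proof (rule ccontr)
      assume "\<not> J y \<le> J x"
      then have "s y < s x"
        using R unfolding s_def by (intro divide_strict_left_mono power_strict_increasing) auto
      then show False using y by simp
    qed
    have cy: "ennreal (norm (m y (2 * s y) - c)) \<le> ennreal L"
    proof -
      have "ennreal (norm (m y (2 * s y) - c)) \<le> avg (dev c) y (2 * s y)"
        using s_pos[of y] by (intro norm_mean_diff_le[OF f_loc]) simp
      also have "\<dots> \<le> ennreal L"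
        unfolding s2[OF yE] using nP[of "J y - 1" y] J0[OF yE] by (simp add: P_def not_less)
      finally show ?thesis .
    qed
    have "loc_max z R x \<le> ennreal L + loc_max y (2 * s y) x"
      unfolding loc_max_def[of z R]
    proof (rule SUP_least)
      fix j :: nat
      show "avg (dev (m z R)) x (R / 2 ^ j) \<le> ennreal L + loc_max y (2 * s y) x"
      proof (cases "j < J x")
        case True
        then show ?thesis
          using nP[OF True] by (simp add: P_def c_def not_less add_increasing2)
      next
        case False
        \<comment> \<open>The exponent of the radius \<open>2 * s y\<close> is
          \<open>J y - 1\<close>. As J y \<le> J x \<le> j, the radius \<open>R / 2 ^ j\<close> is
          one of the dyadic fractions over which \<open>loc_max y (2 * s y)\<close> is
          taken.\<close>
        define i where "i = j - (J y - 1)"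
        have j: "j = (J y - 1) + i" using False Jyx unfolding i_def by simp
        have r: "R / 2 ^ j = 2 * s y / 2 ^ i"
          unfolding s2[OF yE] j by (simp add: power_add)
        have "avg (dev c) x (R / 2 ^ j)
            \<le> avg (dev (m y (2 * s y))) x (R / 2 ^ j) + ennreal (norm (m y (2 * s y) - c))"
          using R by (intro avg_dev_change) simp
        also have "\<dots> \<le> loc_max y (2 * s y) x + ennreal L"
          unfolding r loc_max_def by (intro add_mono cy SUP_upper) auto
        finally show ?thesis by (simp add: c_def add.commute)
      qed
    qed
    then have "min (loc_max z R x) N \<le> min (ennreal L + loc_max y (2 * s y) x) N"
      by (intro min.mono) auto
    also have "\<dots> \<le> ennreal L + min (loc_max y (2 * s y) x) N"
    proof (cases "loc_max y (2 * s y) x \<le> N")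
      case True
      then show ?thesis by (simp add: min.absorb1)
    next
      case False
      then have "min (loc_max y (2 * s y) x) N = N" by (simp add: min_def)
      then show ?thesis by (simp add: add_increasing min.coboundedI2)
    qed
    also have "\<dots> = ennreal L + ?F y x"
      using y by simp
    also have "\<dots> \<le> ennreal L + (\<integral>\<^sup>+i. ?F i x \<partial>count_space I)"
      by (intro add_left_mono nn_integral_ge_point y(1))
    finally show ?thesis .
  qed
  \<comment> \<open>A Chebyshev estimate: each selected ball has average above \<open>L\<close>, and
    by disjointness these averages are all paid for by one integral over
    \<open>ball z (2 * R)\<close>.\<close>
  define S where "S = (\<integral>\<^sup>+i. emeasure M (ball i (s i)) \<partial>count_space I)"
  have "ennreal L * S = (\<integral>\<^sup>+i. ennreal L * emeasure M (ball i (s i)) \<partial>count_space I)"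
    unfolding S_def by (subst nn_integral_cmult) auto
  also have "\<dots> \<le> (\<integral>\<^sup>+i. (\<integral>\<^sup>+x. dev c x * indicator (ball i (s i)) x \<partial>M) \<partial>count_space I)"
  proof (rule nn_integral_mono)
    fix i assume "i \<in> space (count_space I)"
    then have "i \<in> E" using I by auto
    then have "ennreal L \<le> avg (dev c) i (s i)"
      using PJ[of i] by (simp add: P_def s_def less_imp_le)
    then show "ennreal L * emeasure M (ball i (s i)) \<le> (\<integral>\<^sup>+x. dev c x * indicator (ball i (s i)) x \<partial>M)"
      by (subst avg_mult[OF s_pos, symmetric]) (intro mult_right_mono, auto)
  qed
  also have "\<dots> = (\<integral>\<^sup>+x. (\<integral>\<^sup>+i. dev c x * indicator (ball i (s i)) x \<partial>count_space I) \<partial>M)"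
    by (intro nn_integral_count_space_nn_integral[symmetric] cI) measurable
  also have "\<dots> \<le> (\<integral>\<^sup>+x\<in>ball z (2 * R). dev c x \<partial>M)"
  proof (rule nn_integral_mono)
    fix x
    show "(\<integral>\<^sup>+i. dev c x * indicator (ball i (s i)) x \<partial>count_space I) \<le> dev c x * indicator (ball z (2 * R)) x"
    proof (cases "\<exists>i\<in>I. x \<in> ball i (s i)")
      case False
      then have "(\<integral>\<^sup>+i. dev c x * indicator (ball i (s i)) x \<partial>count_space I) = (\<integral>\<^sup>+i. 0 \<partial>count_space I)"
        by (intro nn_integral_cong) auto
      then show ?thesis by simp
    next
      case True
      then obtain i where i: "i \<in> I" "x \<in> ball i (s i)" by blast
      have "(\<integral>\<^sup>+k. dev c x * indicator (ball k (s k)) x \<partial>count_space I)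
          = (\<integral>\<^sup>+k. dev c x * indicator {i} k \<partial>count_space I)"
      proof (intro nn_integral_cong)
        fix k assume "k \<in> space (count_space I)"
        then have "x \<in> ball k (s k) \<longleftrightarrow> k = i" using i disj[of k i]
          by (cases "k = i") (auto simp del: mem_ball)
        then show "dev c x * indicator (ball k (s k)) x = dev c x * indicator {i} k"
          by (simp add: indicator_def)
      qed
      also have "\<dots> = dev c x"
        using i by (subst nn_integral_cmult_indicator) auto
      finally show ?thesis using sub[OF i(1)] i(2) by (auto simp: indicator_def)
    qed
  qed
  also have "\<dots> = avg (dev c) z (2 * R) * emeasure M (ball z (2 * R))"
    using R by (subst avg_mult) auto
  also have "\<dots> \<le> ennreal (2 * (A * b)) * (ennreal A * emeasure M (ball z R))"
    using avg_dev_pow2[OF R, of z 1] R by (intro mult_mono doubling) (auto simp: c_def)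
  finally have LS: "ennreal L * S \<le> ennreal (2 * (A * b)) * (ennreal A * emeasure M (ball z R))" .
  have "ennreal L * (ennreal A * S) = ennreal A * (ennreal L * S)" by (simp add: ac_simps)
  also have "\<dots> \<le> ennreal A * (ennreal (2 * (A * b)) * (ennreal A * emeasure M (ball z R)))"
    by (intro mult_left_mono LS) simp
  also have "\<dots> = ennreal (A * (2 * (A * b)) * A) * emeasure M (ball z R)"
    using A_ge_1 b_pos by (simp add: ennreal_mult mult.assoc)
  also have "A * (2 * (A * b)) * A = L * (1 / 2)" by (simp add: power3_eq_cube)
  also have "ennreal (L * (1 / 2)) = ennreal L * (1 / 2)"
    using L_pos by (simp only: ennreal_mult' ennreal_half less_imp_le)
  finally have "ennreal L * (ennreal A * S) \<le> ennreal L * (1 / 2 * emeasure M (ball z R))"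
    by (simp add: mult.assoc)
  then have AS: "ennreal A * S \<le> 1 / 2 * emeasure M (ball z R)"
    using L_pos by (subst (asm) ennreal_mult_le_mult_iff) auto
  have "(\<integral>\<^sup>+x\<in>ball z R. min (loc_max z R x) N \<partial>M)
      \<le> (\<integral>\<^sup>+x. ennreal L * indicator (ball z R) x + (\<integral>\<^sup>+i. ?F i x \<partial>count_space I) \<partial>M)"
    using point by (intro nn_integral_mono) (auto simp: indicator_def)
  also have "\<dots> = ennreal L * emeasure M (ball z R) + (\<integral>\<^sup>+x. (\<integral>\<^sup>+i. ?F i x \<partial>count_space I) \<partial>M)"
    using cI by (subst nn_integral_add)
      (auto intro!: measurable_nn_integral_count_space simp: nn_integral_cmult_indicator)
  also have "(\<integral>\<^sup>+x. (\<integral>\<^sup>+i. ?F i x \<partial>count_space I) \<partial>M) = (\<integral>\<^sup>+i. (\<integral>\<^sup>+x. ?F i x \<partial>M) \<partial>count_space I)"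
    by (intro nn_integral_count_space_nn_integral cI) measurable
  also have "\<dots> \<le> (\<integral>\<^sup>+i. (a * ennreal A) * emeasure M (ball i (s i)) \<partial>count_space I)"
  proof (rule nn_integral_mono)
    fix i
    have "(\<integral>\<^sup>+x. ?F i x \<partial>M) = avg (\<lambda>x. min (loc_max i (2 * s i) x) N) i (2 * s i) * emeasure M (ball i (2 * s i))"
      using s_pos[of i] by (subst avg_mult) auto
    also have "\<dots> \<le> a * (ennreal A * emeasure M (ball i (s i)))"
      using s_pos[of i] by (intro mult_mono a doubling) auto
    finally show "(\<integral>\<^sup>+x. ?F i x \<partial>M) \<le> (a * ennreal A) * emeasure M (ball i (s i))"
      by (simp add: mult.assoc)
  qed
  also have "\<dots> = a * (ennreal A * S)"
    unfolding S_def by (subst nn_integral_cmult) (auto simp: mult.assoc)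
  also have "\<dots> \<le> a * (1 / 2 * emeasure M (ball z R))"
    by (intro mult_left_mono AS) simp
  finally show "(\<integral>\<^sup>+x\<in>ball z R. min (loc_max z R x) N \<partial>M) \<le> (ennreal L + a * (1 / 2)) * emeasure M (ball z R)"
    by (simp add: distrib_right mult.assoc add_left_mono)
qed

text \<open>For the cut-off at \<open>of_nat n\<close> the supremum \<open>a\<close> over all balls
  is at most n, hence finite, and a \<le> L + a / 2 can be solved to a \<le> 2 L. Monotone
  convergence then removes the cut-off.\<close>

lemma avg_loc_max:
  assumes R: "R > 0"
  shows "avg (loc_max z R) z R \<le> ennreal (2 * L)"
proof -
  have trunc: "avg (\<lambda>x. min (loc_max z R x) (of_nat n)) z R \<le> ennreal (2 * L)"
    if "R > 0" for n z R
  proof -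
    define a where "a = (SUP (z, R) \<in> UNIV \<times> {0<..}. avg (\<lambda>x. min (loc_max z R x) (of_nat n)) z R)"
    have a: "avg (\<lambda>x. min (loc_max z R x) (of_nat n)) z R \<le> a" if "R > 0" for z R
      unfolding a_def using that by (intro SUP_upper2[of "(z, R)"]) auto
    have "a \<le> of_nat n"
      unfolding a_def
    proof (rule SUP_least, clarsimp)
      fix z :: 'a and R :: real assume "0 < R"
      have "avg (\<lambda>x. min (loc_max z R x) (of_nat n)) z R \<le> avg (\<lambda>x. of_nat n) z R"
        by (intro avg_mono) auto
      then show "avg (\<lambda>x. min (loc_max z R x) (of_nat n)) z R \<le> of_nat n"
        using \<open>0 < R\<close> by (simp add: avg_const)
    qed
    then have "a \<noteq> top" using ennreal_of_nat_neq_top[of n] neq_top_trans by blast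
    then obtain \<alpha> where \<alpha>: "a = ennreal \<alpha>" "\<alpha> \<ge> 0" by (cases a) auto
    have "a \<le> ennreal L + a * (1 / 2)"
      unfolding a_def using a loc_max_truncated_step[of _ "of_nat n" a]
      by (intro SUP_least) (auto simp: a_def)
    also have "\<dots> = ennreal (L + \<alpha> * (1 / 2))"
    proof -
      have "a * (1 / 2) = ennreal (\<alpha> * (1 / 2))"
        using \<alpha> by (simp only: ennreal_mult' ennreal_half)
      then show ?thesis using L_pos \<alpha> by simp
    qed
    finally have "\<alpha> \<le> L + \<alpha> * (1 / 2)"
      unfolding \<alpha> using L_pos \<alpha> by (subst (asm) ennreal_le_iff) auto
    then have "a \<le> ennreal (2 * L)" unfolding \<alpha> by (intro ennreal_leI) simp
    with a[OF that, of z] show ?thesis by simp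
  qed
  have "(\<integral>\<^sup>+x\<in>ball z R. loc_max z R x \<partial>M)
      = (\<integral>\<^sup>+x. (SUP n. min (loc_max z R x) (of_nat n) * indicator (ball z R) x) \<partial>M)"
  proof (rule nn_integral_cong)
    fix x
    have "(SUP n. min (loc_max z R x) (of_nat n)) = min (loc_max z R x) (SUP n. of_nat n)"
      by (simp add: inf_SUP flip: inf_min)
    then have "(SUP n. min (loc_max z R x) (of_nat n)) = loc_max z R x"
      by (simp add: ennreal_SUP_of_nat_eq_top)
    then show "loc_max z R x * indicator (ball z R) x
        = (SUP n. min (loc_max z R x) (of_nat n) * indicator (ball z R) x)"
      by (simp flip: SUP_mult_right_ennreal)
  qed
  also have "\<dots> = (SUP n. \<integral>\<^sup>+x\<in>ball z R. min (loc_max z R x) (of_nat n) \<partial>M)"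
    by (intro nn_integral_monotone_convergence_SUP)
       (auto simp: incseq_def le_fun_def intro!: mult_right_mono min.mono)
  also have "\<dots> \<le> ennreal (2 * L) * emeasure M (ball z R)"
  proof (rule SUP_least)
    fix n
    show "(\<integral>\<^sup>+x\<in>ball z R. min (loc_max z R x) (of_nat n) \<partial>M) \<le> ennreal (2 * L) * emeasure M (ball z R)"
      unfolding avg_mult[OF R, symmetric] by (intro mult_right_mono trunc R) simp
  qed
  finally show ?thesis by (rule avg_leI[OF R])
qed

end

section \<open>Kernel estimates\<close>

text \<open>Decay of a kernel across dyadic annuli, against the factor \<open>Suc j\<close> by which
  averages of the deviation grow.\<close>

definition ksum :: "real \<Rightarrow> real" where
  "ksum \<eta> = (\<Sum>j. 2 powr (- \<eta> * real j) * real (Suc j))"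

text \<open>Half of the exponent absorbs the linear factor; the other half leaves a geometric
  series.\<close>

lemma summable_ksum:
  assumes "\<eta> > 0"
  shows "summable (\<lambda>j. 2 powr (- \<eta> * real j) * real (Suc j))"
proof -
  obtain C where C: "\<And>k::nat. real (Suc k) \<le> C * 2 powr (\<eta> / 2 * real k)"
    using Suc_le_powr[of "\<eta> / 2"] assms by auto
  have "summable (\<lambda>j. C * (2 powr (- \<eta> / 2)) ^ j)"
    using assms by (intro summable_mult summable_geometric) (auto simp: powr_less_one)
  then show ?thesis
  proof (rule summable_comparison_test')
    fix j :: nat
    have "2 powr (- \<eta> * real j) * real (Suc j) \<le> 2 powr (- \<eta> * real j) * (C * 2 powr (\<eta> / 2 * real j))"
      by (intro mult_left_mono C) simp
    also have "\<dots> = C * 2 powr (- \<eta> * real j + \<eta> / 2 * real j)"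
      by (simp only: powr_add ac_simps)
    also have "- \<eta> * real j + \<eta> / 2 * real j = (- \<eta> / 2) * real j" by (simp add: field_simps)
    also have "2 powr ((- \<eta> / 2) * real j) = (2 powr (- \<eta> / 2)) ^ j"
      by (simp add: powr_realpow[symmetric] powr_powr)
    finally show "norm (2 powr (- \<eta> * real j) * real (Suc j)) \<le> C * (2 powr (- \<eta> / 2)) ^ j"
      by simp
  qed
qed

lemma ksum_nonneg: "\<eta> > 0 \<Longrightarrow> 0 \<le> ksum \<eta>"
  unfolding ksum_def by (intro suminf_nonneg summable_ksum) auto

lemma ratio_le_1: "0 < u \<Longrightarrow> 0 \<le> d \<Longrightarrow> u / (u + d) \<le> (1 :: real)"
  by simp

context doubling_space
begin

text \<open>\<open>D\<close> is the constant of the kernel bound, \<open>A\<close> pays for passing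
  from the ball of radius \<open>2 ^ i * u\<close> to the next dyadic one, and
  \<open>2 powr \<eta>\<close> for the shift from i to \<open>Suc i\<close> in the decay.\<close>

definition kc :: "real \<Rightarrow> real \<Rightarrow> real" where
  "kc D \<eta> = D * A * 2 powr \<eta> * ksum \<eta>"

text \<open>The kernel bound is dominated pointwise by normalised indicators of dyadic balls with
  geometrically decaying weights. For 2^i u \<le> dist x y < 2^(i+1) u take j = i + 1: the ball of
  radius dist x y contains that of radius 2^i u, whose measure is at least 1/A of that of the next
  one.\<close>

lemma kernel_annulus:
  assumes u: "u > 0" and \<eta>: "\<eta> > 0" and D: "D \<ge> 0"
  obtains j :: nat where "dist x y < 2 ^ j * u"
    "D * (1 / (vol M u x + vol2 M x y)) * (u / (u + dist x y)) powr \<eta>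
      \<le> D * A * 2 powr \<eta> * 2 powr (- \<eta> * real j) / measure M (ball x (2 ^ j * u))"
proof (cases "dist x y < u")
  case True
  have V: "vol M u x > 0" unfolding vol_def using measure_ball_pos[OF u] .
  have "1 / (vol M u x + vol2 M x y) \<le> 1 / vol M u x"
    using V by (intro divide_left_mono) (auto simp: vol2_def intro!: mult_pos_pos add_pos_nonneg)
  moreover have "(u / (u + dist x y)) powr \<eta> \<le> 1"
    using u \<eta> ratio_le_1[OF u zero_le_dist[of x y]] by (intro powr_le1) auto
  ultimately have "1 / (vol M u x + vol2 M x y) * (u / (u + dist x y)) powr \<eta> \<le> 1 / vol M u x * 1"
    using V by (intro mult_mono) auto
  also have "\<dots> \<le> A * 2 powr \<eta> * (1 / vol M u x)"
    using A_ge_1 V \<eta> mult_mono[of 1 A 1 "2 powr \<eta>"] mult_right_mono[of 1 "A * 2 powr \<eta>" "1 / vol M u x"]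
    by (simp add: ge_one_powr_ge_zero)
  finally have "D * (1 / (vol M u x + vol2 M x y) * (u / (u + dist x y)) powr \<eta>) \<le> D * (A * 2 powr \<eta> * (1 / vol M u x))"
    using D by (rule mult_left_mono)
  then show ?thesis
    using True by (intro that[of 0]) (auto simp: vol_def mult.assoc)
next
  case False
  then obtain i :: nat where i: "2 ^ i * u \<le> dist x y" "dist x y < 2 * (2 ^ i * u)"
    using dyadic_between[of u "dist x y"] u by auto
  let ?v = "2 ^ i * u"
  have v: "?v > 0" using u by simp
  have V: "measure M (ball x (2 * ?v)) > 0" by (rule measure_ball_pos) (use v in simp)
  have "measure M (ball x (2 * ?v)) \<le> A * measure M (ball x ?v)"
    using v by (rule measure_doubling)
  also have "\<dots> \<le> A * vol2 M x y"
    unfolding vol2_def using i A_ge_1 ball_fin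
    by (intro mult_left_mono measure_mono_fmeasurable) (auto simp: fmeasurable_def)
  also have "\<dots> \<le> A * (vol M u x + vol2 M x y)"
    using A_ge_1 by (intro mult_left_mono) (auto simp: vol_def)
  finally have le: "measure M (ball x (2 * ?v)) \<le> A * (vol M u x + vol2 M x y)" .
  then have pos: "vol M u x + vol2 M x y > 0"
    using V A_ge_1 by (smt (verit) mult_nonneg_nonpos)
  have "1 / (vol M u x + vol2 M x y) \<le> A / measure M (ball x (2 * ?v))"
    using le pos V by (simp add: field_simps)
  moreover have "(u / (u + dist x y)) powr \<eta> \<le> 2 powr \<eta> * 2 powr (- \<eta> * real (Suc i))"
  proof -
    have "(u / (u + dist x y)) powr \<eta> \<le> (1 / 2 ^ i) powr \<eta>"
      using i u \<eta> by (intro powr_mono2) (auto simp: field_simps)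
    also have "1 / 2 ^ i = 2 powr (- real i)"
      by (simp add: powr_minus powr_realpow field_simps)
    also have "(2 powr (- real i)) powr \<eta> = 2 powr (\<eta> + (- \<eta> * real (Suc i)))"
      by (simp add: powr_powr algebra_simps)
    finally show ?thesis by (simp only: powr_add)
  qed
  ultimately have "1 / (vol M u x + vol2 M x y) * (u / (u + dist x y)) powr \<eta>
      \<le> A / measure M (ball x (2 * ?v)) * (2 powr \<eta> * 2 powr (- \<eta> * real (Suc i)))"
    using A_ge_1 V by (intro mult_mono) auto
  then have "D * (1 / (vol M u x + vol2 M x y) * (u / (u + dist x y)) powr \<eta>)
      \<le> D * (A / measure M (ball x (2 * ?v)) * (2 powr \<eta> * 2 powr (- \<eta> * real (Suc i))))"
    using D by (rule mult_left_mono)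
  then show ?thesis
    using i by (intro that[of "Suc i"]) (auto simp: mult.assoc)
qed

text \<open>The suitable j depends on y. Bounding its term by the whole series removes this
  dependence, and each term of the series integrates to an average over a dyadic ball.\<close>

lemma kernel_integral_le:
  assumes [measurable]: "h \<in> borel_measurable M"
    and u: "u > 0" and \<eta>: "\<eta> > 0" and D: "D \<ge> 0" and g: "g \<ge> 0"
    and k: "\<And>y. k y \<le> D * (1 / (vol M u x + vol2 M x y)) * (u / (u + dist x y)) powr \<eta>"
    and h: "\<And>j::nat. avg h x (2 ^ j * u) \<le> ennreal (real (Suc j) * g)"
  shows "(\<integral>\<^sup>+y. ennreal (k y) * h y \<partial>M) \<le> ennreal (kc D \<eta> * g)"
proof -
  define c where "c j = D * A * 2 powr \<eta> * 2 powr (- \<eta> * real j)" for j :: nat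
  have c0: "c j \<ge> 0" for j using D A_ge_1 by (simp add: c_def)
  define B where "B j = ball x (2 ^ j * u)" for j :: nat
  have [measurable]: "B j \<in> sets M" for j by (simp add: B_def)
  have EB: "emeasure M (B j) = ennreal (measure M (B j))" for j
    by (simp add: B_def emeasure_ball)
  have mB: "measure M (B j) > 0" for j
    unfolding B_def using u by (intro measure_ball_pos) simp
  let ?T = "\<lambda>j y. ennreal (c j) * ((h y * indicator (B j) y) / emeasure M (B j))"
  have "(\<integral>\<^sup>+y. ennreal (k y) * h y \<partial>M) \<le> (\<integral>\<^sup>+y. (\<Sum>j. ?T j y) \<partial>M)"
  proof (rule nn_integral_mono)
    fix y
    obtain j where j: "dist x y < 2 ^ j * u"
      "D * (1 / (vol M u x + vol2 M x y)) * (u / (u + dist x y)) powr \<eta> \<le> c j / measure M (B j)"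
      unfolding c_def B_def using kernel_annulus[OF u \<eta> D, of x y] by blast
    have "ennreal (k y) \<le> ennreal (c j / measure M (B j))"
      using k[of y] j(2) by (intro ennreal_leI) linarith
    also have "\<dots> = ennreal (c j) / emeasure M (B j)"
      using c0 mB by (simp add: EB divide_ennreal)
    finally have "ennreal (k y) * h y \<le> ennreal (c j) / emeasure M (B j) * h y"
      by (intro mult_right_mono) auto
    also have "\<dots> = ?T j y"
      using j(1) by (simp add: B_def ennreal_times_divide ennreal_divide_times divide_ennreal_def ac_simps)
    also have "\<dots> \<le> (\<Sum>j. ?T j y)"
      using sum_le_suminf[of "\<lambda>j. ?T j y" "{j}"] by (simp add: summableI)
    finally show "ennreal (k y) * h y \<le> (\<Sum>j. ?T j y)" .
  qed
  also have "\<dots> = (\<Sum>j. \<integral>\<^sup>+y. ?T j y \<partial>M)"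
    by (intro nn_integral_suminf) measurable
  also have "\<dots> = (\<Sum>j. ennreal (c j) * avg h x (2 ^ j * u))"
    by (simp add: nn_integral_cmult nn_integral_divide avg_def B_def)
  also have "\<dots> \<le> (\<Sum>j. ennreal (c j * (real (Suc j) * g)))"
  proof (intro suminf_le summableI)
    fix j
    show "ennreal (c j) * avg h x (2 ^ j * u) \<le> ennreal (c j * (real (Suc j) * g))"
      using h[of j] c0[of j] g by (subst ennreal_mult) (auto intro: mult_left_mono)
  qed
  also have "\<dots> = (\<Sum>j. ennreal (D * A * 2 powr \<eta> * g * (2 powr (- \<eta> * real j) * real (Suc j))))"
    by (simp add: c_def ac_simps)
  also have "\<dots> = ennreal (\<Sum>j. D * A * 2 powr \<eta> * g * (2 powr (- \<eta> * real j) * real (Suc j)))"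
    using D A_ge_1 g by (intro suminf_ennreal2 summable_mult summable_ksum \<eta>) auto
  also have "(\<Sum>j. D * A * 2 powr \<eta> * g * (2 powr (- \<eta> * real j) * real (Suc j))) = kc D \<eta> * g"
    unfolding kc_def ksum_def by (subst suminf_mult[OF summable_ksum[OF \<eta>]]) (simp add: ac_simps)
  finally show ?thesis .
qed

end

section \<open>Operators compared with means\<close>

context bmo
begin

text \<open>Since the kernel has integral 1, the constant \<open>m x u\<close> can be subtracted
  from f under the integral, leaving the deviation. The same splitting shows that the kernel is
  integrable against f.\<close>

lemma kernel_near_mean:
  assumes u: "u > 0" and \<eta>: "\<eta> > 0" and D: "D \<ge> 0"
    and k: "\<And>y. norm (K x y) \<le> D * (1 / (vol M u x + vol2 M x y)) * (u / (u + dist x y)) powr \<eta>"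
    and int: "integrable M (K x)" and one: "(LINT y|M. K x y) = 1"
  shows "integrable M (\<lambda>y. K x y * f y)"
    "norm (kernel_op M K f x - m x u) \<le> kc D \<eta> * (A * b)"
proof -
  have [measurable]: "K x \<in> borel_measurable M" using int by auto
  have "(\<integral>\<^sup>+y. ennreal (norm (K x y * (f y - m x u))) \<partial>M)
      = (\<integral>\<^sup>+y. ennreal (norm (K x y)) * dev (m x u) y \<partial>M)"
    by (simp add: norm_mult ennreal_mult)
  also have "\<dots> \<le> ennreal (kc D \<eta> * (A * b))"
    using A_ge_1 b_pos avg_dev_pow2[OF u, of x]
    by (intro kernel_integral_le[OF _ u \<eta> D _ k]) auto
  finally have le: "(\<integral>\<^sup>+y. ennreal (norm (K x y * (f y - m x u))) \<partial>M) \<le> ennreal (kc D \<eta> * (A * b))" .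
  then have i1: "integrable M (\<lambda>y. K x y * (f y - m x u))"
    by (intro integrableI_bounded) (auto intro: le_less_trans)
  have i2: "integrable M (\<lambda>y. K x y * m x u)" using int by simp
  have "integrable M (\<lambda>y. K x y * (f y - m x u) + K x y * m x u)"
    using i1 i2 by (rule Bochner_Integration.integrable_add)
  then show fi: "integrable M (\<lambda>y. K x y * f y)" by (simp add: algebra_simps)
  have "kernel_op M K f x - m x u = (LINT y|M. K x y * f y) - (LINT y|M. K x y * m x u)"
    using one int by (simp add: kernel_op_def)
  also have "\<dots> = (LINT y|M. K x y * (f y - m x u))"
    by (subst Bochner_Integration.integral_diff[OF fi i2, symmetric]) (simp add: algebra_simps)
  finally have "ennreal (norm (kernel_op M K f x - m x u)) \<le> ennreal (kc D \<eta> * (A * b))"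
    using integral_norm_bound_ennreal[OF i1] le by simp
  moreover have "kc D \<eta> * (A * b) \<ge> 0"
    using D A_ge_1 b_pos ksum_nonneg[OF \<eta>] by (simp add: kc_def)
  ultimately show "norm (kernel_op M K f x - m x u) \<le> kc D \<eta> * (A * b)" by simp
qed

end

locale bmo_rho = bmo M A f b
  for M :: "'a::metric_space measure" and A f b +
  fixes \<rho> :: "'a \<Rightarrow> real"
  assumes \<rho>_pos: "\<rho> x > 0"
    and large: "r \<ge> \<rho> x \<Longrightarrow> avg (\<lambda>y. ennreal (norm (f y))) x r \<le> ennreal b"
begin

lemma norm_mean_le: "r > 0 \<Longrightarrow> ennreal (norm (m x r)) \<le> avg (\<lambda>y. ennreal (norm (f y))) x r"
  using norm_mean_diff_le[OF f_loc, of r x 0] by simp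

lemma norm_mean_large: "r \<ge> \<rho> x \<Longrightarrow> norm (m x r) \<le> b"
  using order_trans[OF norm_mean_le large[of x r]] \<rho>_pos[of x] b_pos by auto

text \<open>Below \<rho> x the mean at scale v is linked to the one at scale \<rho> x. In the
  summand 2, one unit stands for the oscillation at scale v and one for the mean at \<rho>
  x.\<close>

lemma avg_norm_le:
  assumes C: "\<And>k::nat. real (Suc k) \<le> C * 2 powr (\<theta> * real k)" and \<theta>: "\<theta> > 0" and v: "v > 0"
  shows "avg (\<lambda>y. ennreal (norm (f y))) x v \<le> ennreal ((2 + C * (\<rho> x / v) powr \<theta>) * (A * b))"
proof -
  have C0: "C \<ge> 0" using C[of 0] by simp
  have Ab: "b \<le> A * b" using A_ge_1 b_pos by simp
  show ?thesis
  proof (cases "\<rho> x \<le> v")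
    case True
    have "avg (\<lambda>y. ennreal (norm (f y))) x v \<le> ennreal b" by (rule large[OF True])
    also have "b \<le> (2 + C * (\<rho> x / v) powr \<theta>) * (A * b)"
    proof -
      have "0 \<le> C * (\<rho> x / v) powr \<theta>" using C0 by simp
      then show ?thesis
        using b_pos A_ge_1 mult_right_mono[of 1 "2 + C * (\<rho> x / v) powr \<theta>" "A * b"]
        by (intro order_trans[OF Ab]) simp
    qed
    finally show ?thesis by (simp add: ennreal_leI)
  next
    case False
    have "avg (\<lambda>y. ennreal (norm (f y))) x v \<le> avg (dev (m x v)) x v + ennreal (norm (m x v))"
      using avg_dev_change[OF v, of 0 x "m x v"] by simp
    also have "\<dots> \<le> ennreal b + ennreal (b + C * (A * b) * (\<rho> x / v) powr \<theta>)"
    proof (intro add_mono osc v ennreal_leI)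
      show "norm (m x v) \<le> b + C * (A * b) * (\<rho> x / v) powr \<theta>"
        using mean_powr[OF C \<theta> v, of "\<rho> x" x] False norm_mean_large[of x "\<rho> x"]
          norm_triangle_ineq[of "m x v - m x (\<rho> x)" "m x (\<rho> x)"] by simp
    qed
    also have "\<dots> = ennreal (2 * b + C * (A * b) * (\<rho> x / v) powr \<theta>)"
      using b_pos C0 A_ge_1 by (subst ennreal_plus[symmetric]) auto
    also have "\<dots> \<le> ennreal ((2 + C * (\<rho> x / v) powr \<theta>) * (A * b))"
      using Ab by (intro ennreal_leI) (simp add: algebra_simps)
    finally show ?thesis .
  qed
qed

lemma kernel_perturbation:
  assumes C: "\<And>k::nat. real (Suc k) \<le> C * 2 powr (\<delta> * real k)" and \<delta>: "\<delta> > 0"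
    and u: "u > 0" and \<eta>: "\<eta> > 0" and D: "D \<ge> 0"
    and k: "\<And>y. norm (K x y - K' x y) \<le>
      D * (u / (u + \<rho> x)) powr \<delta> * (1 / (vol M u x + vol2 M x y)) * (u / (u + dist x y)) powr \<eta>"
    and [measurable]: "K x \<in> borel_measurable M" "K' x \<in> borel_measurable M"
    and int: "integrable M (\<lambda>y. K' x y * f y)"
  shows "integrable M (\<lambda>y. K x y * f y)"
    "norm (kernel_op M K f x - kernel_op M K' f x) \<le> kc D \<eta> * ((2 + C) * (A * b))"
proof -
  have C0: "C \<ge> 0" using C[of 0] by simp
  define q where "q = (u / (u + \<rho> x)) powr \<delta>"
  define g where "g = (2 + C * (\<rho> x / u) powr \<delta>) * (A * b)"
  have g0: "g \<ge> 0" using C0 A_ge_1 b_pos by (simp add: g_def)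
  have q0: "q \<ge> 0" by (simp add: q_def)
  have av: "avg (\<lambda>y. ennreal (norm (f y))) x (2 ^ j * u) \<le> ennreal (real (Suc j) * g)" for j
  proof -
    have "avg (\<lambda>y. ennreal (norm (f y))) x (2 ^ j * u)
        \<le> ennreal ((2 + C * (\<rho> x / (2 ^ j * u)) powr \<delta>) * (A * b))"
      using u by (intro avg_norm_le C \<delta>) simp
    also have "\<dots> \<le> ennreal g"
    proof -
      have "u \<le> 2 ^ j * u" using u mult_right_mono[of 1 "2 ^ j" u] by simp
      then have "\<rho> x / (2 ^ j * u) \<le> \<rho> x / u"
        using u \<rho>_pos[of x] by (intro divide_left_mono) auto
      then show ?thesis
        unfolding g_def using u \<rho>_pos[of x] \<delta> C0 A_ge_1 b_pos
        by (intro ennreal_leI mult_right_mono add_left_mono mult_left_mono powr_mono2) auto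
    qed
    also have "\<dots> \<le> ennreal (real (Suc j) * g)"
      using g0 by (intro ennreal_leI) (simp add: algebra_simps)
    finally show ?thesis .
  qed
  \<comment> \<open>The averages were allowed to grow with the very exponent \<delta> of the
    smallness factor, so the two powers multiply to that of \<rho> x / (u + \<rho> x), which is at
    most 1.\<close>
  have "q * g \<le> (2 + C) * (A * b)"
  proof -
    have "q * (\<rho> x / u) powr \<delta> = (u / (u + \<rho> x) * (\<rho> x / u)) powr \<delta>"
      unfolding q_def using u \<rho>_pos[of x] by (intro powr_mult[symmetric])
    also have "\<dots> \<le> 1"
      using u \<rho>_pos[of x] \<delta> by (intro powr_le1) (auto simp: field_simps)
    finally have 1: "C * (q * (\<rho> x / u) powr \<delta>) \<le> C * 1" using C0 by (intro mult_left_mono)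
    have 2: "q \<le> 1"
      unfolding q_def using u \<rho>_pos[of x] \<delta> by (intro powr_le1) (auto simp: field_simps)
    have "q * g = (2 * q + C * (q * (\<rho> x / u) powr \<delta>)) * (A * b)"
      by (simp add: g_def algebra_simps)
    also have "\<dots> \<le> (2 + C) * (A * b)"
      using 1 2 A_ge_1 b_pos by (intro mult_right_mono) auto
    finally show ?thesis .
  qed
  moreover have kc0: "kc D \<eta> \<ge> 0" using D A_ge_1 ksum_nonneg[OF \<eta>] by (simp add: kc_def)
  ultimately have "kc D \<eta> * (q * g) \<le> kc D \<eta> * ((2 + C) * (A * b))" by (intro mult_left_mono)
  then have kcq: "kc (D * q) \<eta> * g \<le> kc D \<eta> * ((2 + C) * (A * b))"
    by (simp add: kc_def ac_simps)
  have "(\<integral>\<^sup>+y. ennreal (norm ((K x y - K' x y) * f y)) \<partial>M)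
      = (\<integral>\<^sup>+y. ennreal (norm (K x y - K' x y)) * ennreal (norm (f y)) \<partial>M)"
    by (simp add: norm_mult ennreal_mult)
  also have "\<dots> \<le> ennreal (kc (D * q) \<eta> * g)"
    using k D q0 by (intro kernel_integral_le[OF _ u \<eta> _ g0 _ av]) (auto simp: q_def)
  also have "\<dots> \<le> ennreal (kc D \<eta> * ((2 + C) * (A * b)))" using kcq by (rule ennreal_leI)
  finally have le: "(\<integral>\<^sup>+y. ennreal (norm ((K x y - K' x y) * f y)) \<partial>M)
      \<le> ennreal (kc D \<eta> * ((2 + C) * (A * b)))" .
  then have i1: "integrable M (\<lambda>y. (K x y - K' x y) * f y)"
    by (intro integrableI_bounded) (auto intro: le_less_trans)
  have "integrable M (\<lambda>y. (K x y - K' x y) * f y + K' x y * f y)"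
    using i1 int by (rule Bochner_Integration.integrable_add)
  then show fi: "integrable M (\<lambda>y. K x y * f y)" by (simp add: algebra_simps)
  have "kernel_op M K f x - kernel_op M K' f x = (LINT y|M. (K x y - K' x y) * f y)"
    unfolding kernel_op_def
    by (subst Bochner_Integration.integral_diff[OF fi int, symmetric]) (simp add: algebra_simps)
  then have "ennreal (norm (kernel_op M K f x - kernel_op M K' f x)) \<le> ennreal (kc D \<eta> * ((2 + C) * (A * b)))"
    using integral_norm_bound_ennreal[OF i1] le by simp
  then show "norm (kernel_op M K f x - kernel_op M K' f x) \<le> kc D \<eta> * ((2 + C) * (A * b))"
    using kc0 C0 A_ge_1 b_pos by simp
qed

end

section \<open>Subordination\<close>

text \<open>The ratio of the scales t and u = t / (2 sqrt s), raised to the power 1/2, is of order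
  s^(1/4) when u \<le> t and s^(-1/4) otherwise. An exponent below 1 keeps the singularity at s = 0
  integrable against exp (-s) / sqrt s.\<close>

definition subw :: "real \<Rightarrow> real" where
  "subw s = 1 + s powr (1 / 4) + s powr (- 1 / 4)"

lemma subw_measurable [measurable]: "subw \<in> borel_measurable borel"
  unfolding subw_def by measurable

text \<open>The integral of \<open>subw\<close> against the normalised weight: the terms are Gamma
  (p + 1/2) for p = 0, 1/4, -1/4.\<close>

definition subc :: real where
  "subc = (Gamma (1 / 2) + Gamma (3 / 4) + Gamma (1 / 4)) / sqrt pi"

lemma nn_integral_weight:
  assumes "p > - 1 / 2"
  shows "(\<integral>\<^sup>+s. ennreal (indicator {0<..} s * (exp (- s) / sqrt s * s powr p)) \<partial>lborel)
    = ennreal (Gamma (p + 1 / 2))"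
proof -
  have "ennreal (Gamma (p + 1 / 2))
      = (\<integral>\<^sup>+s. ennreal (indicator {0..} s * s powr (p + 1 / 2 - 1) / exp s) \<partial>lborel)"
    using assms by (intro Gamma_conv_nn_integral_real) simp
  also have "\<dots> = (\<integral>\<^sup>+s. ennreal (indicator {0<..} s * (exp (- s) / sqrt s * s powr p)) \<partial>lborel)"
  proof (intro nn_integral_cong arg_cong[where f = ennreal])
    fix s :: real
    show "indicator {0..} s * s powr (p + 1 / 2 - 1) / exp s
        = indicator {0<..} s * (exp (- s) / sqrt s * s powr p)"
    \<comment> \<open>The two indicators differ at s = 0, where both sides vanish because
      \<open>0 powr p\<close> is 0.\<close>
    proof (cases "s > 0")
      case True
      have "s powr (p + 1 / 2 - 1) = s powr (p + - (1 / 2))" by (rule arg_cong) simp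
      also have "\<dots> = s powr p * s powr (- (1 / 2))" by (rule powr_add)
      also have "s powr (- (1 / 2)) = 1 / sqrt s"
        using True by (subst powr_minus) (simp add: powr_half_sqrt field_simps)
      finally show ?thesis using True by (simp add: exp_minus field_simps)
    qed (auto simp: indicator_def)
  qed
  finally show ?thesis by simp
qed

lemma nn_integral_subw:
  "(\<integral>\<^sup>+s. ennreal (indicator {0<..} s * (exp (- s) / sqrt s * subw s)) \<partial>lborel)
    = ennreal (sqrt pi * subc)"
proof -
  let ?g = "\<lambda>p s. indicator {0<..} s * (exp (- s) / sqrt s * s powr p)"
  have nn: "?g p s \<ge> 0" for p and s :: real by (simp add: indicator_def)
  have meas: "(\<lambda>s. ennreal (?g p s)) \<in> borel_measurable lborel" for p
    by measurable
  have "(\<integral>\<^sup>+s. ennreal (indicator {0<..} s * (exp (- s) / sqrt s * subw s)) \<partial>lborel)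
      = (\<integral>\<^sup>+s. ennreal (?g 0 s) + ennreal (?g (1 / 4) s) + ennreal (?g (- 1 / 4) s) \<partial>lborel)"
  proof (intro nn_integral_cong)
    fix s :: real
    have "indicator {0<..} s * (exp (- s) / sqrt s * subw s) = ?g 0 s + ?g (1 / 4) s + ?g (- 1 / 4) s"
      by (cases "s > 0") (simp_all add: subw_def distrib_left)
    then show "ennreal (indicator {0<..} s * (exp (- s) / sqrt s * subw s))
        = ennreal (?g 0 s) + ennreal (?g (1 / 4) s) + ennreal (?g (- 1 / 4) s)"
      by (simp only: ennreal_plus nn add_nonneg_nonneg)
  qed
  also have "\<dots> = (\<integral>\<^sup>+s. ennreal (?g 0 s) \<partial>lborel) + (\<integral>\<^sup>+s. ennreal (?g (1 / 4) s) \<partial>lborel)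
      + (\<integral>\<^sup>+s. ennreal (?g (- 1 / 4) s) \<partial>lborel)"
    by (simp only: nn_integral_add borel_measurable_add meas)
  also have "\<dots> = ennreal (Gamma (0 + 1 / 2)) + ennreal (Gamma (1 / 4 + 1 / 2))
      + ennreal (Gamma (- 1 / 4 + 1 / 2))"
    by (intro arg_cong2[where f = "(+)"] nn_integral_weight) auto
  also have "\<dots> = ennreal (Gamma (1 / 2) + Gamma (3 / 4) + Gamma (1 / 4))"
    by (simp add: Gamma_real_pos less_imp_le)
  also have "\<dots> = ennreal (sqrt pi * subc)"
    by (simp add: subc_def)
  finally show ?thesis .
qed

lemma subc_ge_1: "subc \<ge> 1"
proof -
  have "Gamma (3 / 4 :: real) > 0" "Gamma (1 / 4 :: real) > 0"
    by (intro Gamma_real_pos; simp)+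
  then show ?thesis by (simp add: subc_def Gamma_one_half_real)
qed

text \<open>The weight has total mass Gamma (1/2) = sqrt pi, so the normalised integral is a
  weighted mean and reproduces \<open>c\<close>; the deviation is integrated by
  \<open>nn_integral_subw\<close>.\<close>

lemma subordination:
  fixes H :: "real \<Rightarrow> complex"
  assumes [measurable]: "H \<in> borel_measurable borel" and e: "e \<ge> 0"
    and H: "\<And>s. s > 0 \<Longrightarrow> norm (H s - c) \<le> e * subw s"
  shows "set_integrable lborel {0<..} (\<lambda>s. (exp (- s) / sqrt s) *\<^sub>R H s)"
    "norm ((1 / sqrt pi) *\<^sub>R (LINT s:{0<..}|lborel. (exp (- s) / sqrt s) *\<^sub>R H s) - c) \<le> e * subc"
proof -
  let ?w = "\<lambda>s. exp (- s) / sqrt s" and ?i = "\<lambda>s::real. indicator {0<..} s :: real"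
  have w: "(\<integral>\<^sup>+s. ennreal (?i s * ?w s) \<partial>lborel) = ennreal (sqrt pi)"
  proof -
    have "(\<integral>\<^sup>+s. ennreal (?i s * ?w s) \<partial>lborel) = (\<integral>\<^sup>+s. ennreal (?i s * (?w s * s powr 0)) \<partial>lborel)"
      by (intro nn_integral_cong) (auto simp: indicator_def)
    also have "\<dots> = ennreal (Gamma (0 + 1 / 2))" by (rule nn_integral_weight) simp
    finally show ?thesis by (simp add: Gamma_one_half_real)
  qed
  have w0: "?i s * ?w s \<ge> 0" for s by (simp add: indicator_def)
  have wi: "integrable lborel (\<lambda>s. ?i s * ?w s)"
    using w w0 by (intro integrableI_nonneg) auto
  have wI: "(LINT s|lborel. ?i s * ?w s) = sqrt pi"
    using w w0 by (subst integral_eq_nn_integral) auto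
  have le: "(\<integral>\<^sup>+s. ennreal (norm (?i s *\<^sub>R ?w s *\<^sub>R (H s - c))) \<partial>lborel) \<le> ennreal (e * (sqrt pi * subc))"
  proof -
    have "(\<integral>\<^sup>+s. ennreal (norm (?i s *\<^sub>R ?w s *\<^sub>R (H s - c))) \<partial>lborel)
        \<le> (\<integral>\<^sup>+s. ennreal e * ennreal (?i s * (?w s * subw s)) \<partial>lborel)"
    proof (rule nn_integral_mono)
      fix s :: real
      show "ennreal (norm (?i s *\<^sub>R ?w s *\<^sub>R (H s - c))) \<le> ennreal e * ennreal (?i s * (?w s * subw s))"
      proof (cases "s > 0")
        case True
        have "?w s * norm (H s - c) \<le> ?w s * (e * subw s)"
          using True by (intro mult_left_mono H) auto
        then show ?thesis
          using True e by (simp add: ennreal_mult'[symmetric] ac_simps ennreal_leI)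
      qed (simp add: indicator_def)
    qed
    also have "\<dots> = ennreal e * ennreal (sqrt pi * subc)"
      by (subst nn_integral_cmult, measurable) (simp only: nn_integral_subw)
    finally show ?thesis using e by (simp add: ennreal_mult')
  qed
  have i1: "integrable lborel (\<lambda>s. ?i s *\<^sub>R ?w s *\<^sub>R (H s - c))"
    using le by (intro integrableI_bounded) (auto intro: le_less_trans)
  have i2: "integrable lborel (\<lambda>s. (?i s * ?w s) *\<^sub>R c)"
    using wi by (intro integrable_scaleR_left)
  have "integrable lborel (\<lambda>s. ?i s *\<^sub>R ?w s *\<^sub>R (H s - c) + (?i s * ?w s) *\<^sub>R c)"
    using i1 i2 by (rule Bochner_Integration.integrable_add)
  then have i3: "integrable lborel (\<lambda>s. ?i s *\<^sub>R ?w s *\<^sub>R H s)"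
    by (simp add: scaleR_diff_right)
  then show "set_integrable lborel {0<..} (\<lambda>s. (exp (- s) / sqrt s) *\<^sub>R H s)"
    by (simp add: set_integrable_def)
  have "(LINT s|lborel. (?i s * ?w s) *\<^sub>R c) = sqrt pi *\<^sub>R c"
    using wi wI by (subst integral_scaleR_left) auto
  then have "(1 / sqrt pi) *\<^sub>R (LINT s:{0<..}|lborel. (exp (- s) / sqrt s) *\<^sub>R H s) - c
      = (1 / sqrt pi) *\<^sub>R ((LINT s|lborel. ?i s *\<^sub>R ?w s *\<^sub>R H s) - (LINT s|lborel. (?i s * ?w s) *\<^sub>R c))"
    by (simp add: set_lebesgue_integral_def scaleR_diff_right)
  also have "\<dots> = (1 / sqrt pi) *\<^sub>R (LINT s|lborel. ?i s *\<^sub>R ?w s *\<^sub>R (H s - c))"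
    by (subst Bochner_Integration.integral_diff[OF i3 i2, symmetric]) (simp add: scaleR_diff_right)
  finally have eq: "norm ((1 / sqrt pi) *\<^sub>R (LINT s:{0<..}|lborel. (exp (- s) / sqrt s) *\<^sub>R H s) - c)
      = norm (LINT s|lborel. ?i s *\<^sub>R ?w s *\<^sub>R (H s - c)) / sqrt pi"
    by simp
  have "ennreal (norm (LINT s|lborel. ?i s *\<^sub>R ?w s *\<^sub>R (H s - c))) \<le> ennreal (e * (sqrt pi * subc))"
    using integral_norm_bound_ennreal[OF i1] le by (rule order_trans)
  then have "norm (LINT s|lborel. ?i s *\<^sub>R ?w s *\<^sub>R (H s - c)) \<le> e * (sqrt pi * subc)"
    using e subc_ge_1 by (subst (asm) ennreal_le_iff) auto
  then show "norm ((1 / sqrt pi) *\<^sub>R (LINT s:{0<..}|lborel. (exp (- s) / sqrt s) *\<^sub>R H s) - c) \<le> e * subc"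
    unfolding eq by (simp add: field_simps)
qed

text \<open>The substitution s = t^2 r. Afterwards t occurs only in the exponential and the
  prefactor, so continuity in t needs no continuity of \<open>G\<close>.\<close>

lemma subordination_rescale:
  fixes G :: "real \<Rightarrow> complex"
  assumes t: "t > 0"
  shows "(LINT s:{0<..}|lborel. (exp (- s) / sqrt s) *\<^sub>R G (t / (2 * sqrt s)))
    = t *\<^sub>R (LINT r:{0<..}|lborel. (exp (- t\<^sup>2 * r) / sqrt r) *\<^sub>R G (1 / (2 * sqrt r)))"
    "set_integrable lborel {0<..} (\<lambda>s. (exp (- s) / sqrt s) *\<^sub>R G (t / (2 * sqrt s))) \<longleftrightarrow>
      set_integrable lborel {0<..} (\<lambda>r. (exp (- t\<^sup>2 * r) / sqrt r) *\<^sub>R G (1 / (2 * sqrt r)))"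
proof -
  let ?f = "\<lambda>s::real. indicator {0<..} s *\<^sub>R (exp (- s) / sqrt s) *\<^sub>R G (t / (2 * sqrt s))"
  let ?g = "\<lambda>r::real. indicator {0<..} r *\<^sub>R (exp (- t\<^sup>2 * r) / sqrt r) *\<^sub>R G (1 / (2 * sqrt r))"
  have eq: "?f (0 + t\<^sup>2 * r) = (1 / t) *\<^sub>R ?g r" for r
  proof (cases "r > 0")
    case True
    have "sqrt (t\<^sup>2 * r) = t * sqrt r" using t by (simp add: real_sqrt_mult)
    then show ?thesis using True t by (simp add: field_simps)
  next
    case False
    then have "t\<^sup>2 * r \<le> 0" using t by (simp add: mult_le_0_iff)
    then show ?thesis using False by (simp add: indicator_def)
  qed
  have t2: "t\<^sup>2 \<noteq> 0" using t by simp
  have "(LINT s|lborel. ?f s) = \<bar>t\<^sup>2\<bar> *\<^sub>R (LINT r|lborel. ?f (0 + t\<^sup>2 * r))"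
    by (rule lborel_integral_real_affine[OF t2])
  also have "(LINT r|lborel. ?f (0 + t\<^sup>2 * r)) = (1 / t) *\<^sub>R (LINT r|lborel. ?g r)"
    unfolding eq by (rule integral_scaleR_right)
  also have "\<bar>t\<^sup>2\<bar> *\<^sub>R (1 / t) *\<^sub>R (LINT r|lborel. ?g r) = t *\<^sub>R (LINT r|lborel. ?g r)"
    using t by (simp only: scaleR_scaleR) (simp add: power2_eq_square)
  finally show "(LINT s:{0<..}|lborel. (exp (- s) / sqrt s) *\<^sub>R G (t / (2 * sqrt s)))
    = t *\<^sub>R (LINT r:{0<..}|lborel. (exp (- t\<^sup>2 * r) / sqrt r) *\<^sub>R G (1 / (2 * sqrt r)))"
    by (simp only: set_lebesgue_integral_def)
  have "integrable lborel ?f \<longleftrightarrow> integrable lborel (\<lambda>r. ?f (0 + t\<^sup>2 * r))"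
    using lborel_integrable_real_affine_iff[OF t2, of ?f 0] by simp
  also have "\<dots> \<longleftrightarrow> integrable lborel ?g"
  proof
    assume "integrable lborel (\<lambda>r. ?f (0 + t\<^sup>2 * r))"
    then have "integrable lborel (\<lambda>r. t *\<^sub>R (1 / t) *\<^sub>R ?g r)"
      unfolding eq by (rule integrable_scaleR_right)
    moreover have "t *\<^sub>R (1 / t) *\<^sub>R ?g r = ?g r" for r
      using t by (simp only: scaleR_scaleR) simp
    ultimately show "integrable lborel ?g" by (simp only:)
  next
    assume "integrable lborel ?g"
    then show "integrable lborel (\<lambda>r. ?f (0 + t\<^sup>2 * r))"
      unfolding eq by (rule integrable_scaleR_right)
  qed
  finally show "set_integrable lborel {0<..} (\<lambda>s. (exp (- s) / sqrt s) *\<^sub>R G (t / (2 * sqrt s))) \<longleftrightarrow>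
      set_integrable lborel {0<..} (\<lambda>r. (exp (- t\<^sup>2 * r) / sqrt r) *\<^sub>R G (1 / (2 * sqrt r)))"
    by (simp only: set_integrable_def)
qed

text \<open>Dominated convergence in the rescaled form: the exponential decreases in the time, so
  keeping all times above t / 2 makes the integrand at t / 2 a majorant.\<close>

lemma subordination_LIMSEQ:
  fixes G :: "real \<Rightarrow> complex"
  assumes [measurable]: "G \<in> borel_measurable borel"
    and int: "\<And>t. t > 0 \<Longrightarrow> set_integrable lborel {0<..} (\<lambda>s. (exp (- s) / sqrt s) *\<^sub>R G (t / (2 * sqrt s)))"
    and q: "q \<longlonglongrightarrow> t" "\<And>n. q n \<ge> t / 2" and t: "t > 0"
  shows "(\<lambda>n. LINT s:{0<..}|lborel. (exp (- s) / sqrt s) *\<^sub>R G (q n / (2 * sqrt s)))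
    \<longlonglongrightarrow> (LINT s:{0<..}|lborel. (exp (- s) / sqrt s) *\<^sub>R G (t / (2 * sqrt s)))"
proof -
  have q0: "q n > 0" for n using q(2)[of n] t by linarith
  let ?g = "\<lambda>t r::real. indicator {0<..} r *\<^sub>R (exp (- t\<^sup>2 * r) / sqrt r) *\<^sub>R G (1 / (2 * sqrt r))"
  have "(\<lambda>n. LINT r|lborel. ?g (q n) r) \<longlonglongrightarrow> (LINT r|lborel. ?g t r)"
  proof (rule integral_dominated_convergence)
    have "set_integrable lborel {0<..} (\<lambda>r. (exp (- (t / 2)\<^sup>2 * r) / sqrt r) *\<^sub>R G (1 / (2 * sqrt r)))"
      using int[of "t / 2"] t by (subst subordination_rescale(2)[symmetric]) auto
    then show "integrable lborel (\<lambda>r. norm (?g (t / 2) r))"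
      unfolding set_integrable_def by (rule integrable_norm)
    show "AE r in lborel. (\<lambda>n. ?g (q n) r) \<longlonglongrightarrow> ?g t r"
    proof (intro AE_I2)
      fix r :: real
      show "(\<lambda>n. ?g (q n) r) \<longlonglongrightarrow> ?g t r"
        using q(1) by (cases "r > 0") (auto simp: indicator_def intro!: tendsto_intros)
    qed
    show "AE r in lborel. norm (?g (q n) r) \<le> norm (?g (t / 2) r)" for n
    proof (intro AE_I2)
      fix r :: real
      show "norm (?g (q n) r) \<le> norm (?g (t / 2) r)"
      proof (cases "r > 0")
        case True
        have "(t / 2)\<^sup>2 \<le> (q n)\<^sup>2" using q(2)[of n] t by (intro power_mono) auto
        then have "exp (- (q n)\<^sup>2 * r) \<le> exp (- (t / 2)\<^sup>2 * r)"
          using True by (simp add: mult_right_mono)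
        then have "exp (- (q n)\<^sup>2 * r) / sqrt r * norm (G (1 / (2 * sqrt r)))
            \<le> exp (- (t / 2)\<^sup>2 * r) / sqrt r * norm (G (1 / (2 * sqrt r)))"
          using True by (intro mult_right_mono divide_right_mono) auto
        then show ?thesis using True by simp
      qed (simp add: indicator_def)
    qed
  qed measurable
  then have "(\<lambda>n. q n *\<^sub>R (LINT r|lborel. ?g (q n) r)) \<longlonglongrightarrow> t *\<^sub>R (LINT r|lborel. ?g t r)"
    by (intro tendsto_scaleR q(1))
  then show ?thesis
    unfolding subordination_rescale(1)[OF t] subordination_rescale(1)[OF q0]
    by (simp only: set_lebesgue_integral_def)
qed

text \<open>Replaces nonpositive times by a positive one, so that joint measurability
  holds on the whole line.\<close>
definition ptime :: "real \<Rightarrow> real" where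
  "ptime u = (if u > 0 then u else 1)"

lemma ptime_pos [simp]: "ptime u > 0" "u > 0 \<Longrightarrow> ptime u = u"
  by (auto simp: ptime_def)

lemma jointly_measurable_ptime:
  assumes "jointly_measurable M K"
  shows "(\<lambda>(t, x, y). K (ptime t) x y) \<in> borel_measurable (borel \<Otimes>\<^sub>M (M \<Otimes>\<^sub>M M))"
proof -
  have "ptime \<in> borel \<rightarrow>\<^sub>M restrict_space borel {0<..}"
    unfolding ptime_def by (intro measurable_restrict_space2) auto
  then have "(\<lambda>z. (ptime (fst z), snd z)) \<in>
      (borel \<Otimes>\<^sub>M (M \<Otimes>\<^sub>M M)) \<rightarrow>\<^sub>M (restrict_space borel {0<..} \<Otimes>\<^sub>M (M \<Otimes>\<^sub>M M))"
    by (intro measurable_Pair measurable_snd measurable_compose[OF measurable_fst])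
  from measurable_compose[OF this assms[unfolded jointly_measurable_def]]
  show ?thesis by (simp add: case_prod_beta')
qed

section \<open>Measurability in time and space\<close>

context doubling_space
begin

lemma kernel_op_measurable:
  assumes K: "jointly_measurable M K" and [measurable]: "f \<in> borel_measurable M"
  shows "(\<lambda>(t, x). kernel_op M (K (ptime t)) f x) \<in> borel_measurable (borel \<Otimes>\<^sub>M M)"
proof -
  have [measurable]: "(\<lambda>z. K (ptime (fst z)) (fst (snd z)) (snd (snd z))) \<in> borel_measurable (borel \<Otimes>\<^sub>M (M \<Otimes>\<^sub>M M))"
    using jointly_measurable_ptime[OF K] by (simp add: case_prod_beta')
  have "(\<lambda>z. (fst (fst z), snd (fst z), snd z)) \<in> ((borel \<Otimes>\<^sub>M M) \<Otimes>\<^sub>M M) \<rightarrow>\<^sub>M (borel \<Otimes>\<^sub>M (M \<Otimes>\<^sub>M M))"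
    by measurable
  from measurable_compose[OF this, of "\<lambda>z. K (ptime (fst z)) (fst (snd z)) (snd (snd z))"]
  have [measurable]: "(\<lambda>z. K (ptime (fst (fst z))) (snd (fst z)) (snd z)) \<in> borel_measurable ((borel \<Otimes>\<^sub>M M) \<Otimes>\<^sub>M M)"
    by simp
  show ?thesis
    unfolding kernel_op_def case_prod_beta'
    by (intro sigma_finite_measure.borel_measurable_lebesgue_integral[OF sigma_finite_M])
       (simp add: case_prod_beta')
qed

lemma kernel_measurable:
  assumes K: "jointly_measurable M K" and t: "t > 0"
  shows "K t x \<in> borel_measurable M"
proof -
  have "(\<lambda>y. (t, x, y)) \<in> M \<rightarrow>\<^sub>M (borel \<Otimes>\<^sub>M (M \<Otimes>\<^sub>M M))"
    by (intro measurable_Pair) (auto simp: space_M)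
  from measurable_compose[OF this jointly_measurable_ptime[OF K]]
  show ?thesis using t by simp
qed

lemma kernel_op_time_measurable:
  assumes K: "jointly_measurable M K" and f: "f \<in> borel_measurable M"
  shows "(\<lambda>t. kernel_op M (K (ptime t)) f x) \<in> borel_measurable borel"
proof -
  have "(\<lambda>t. (t, x)) \<in> borel \<rightarrow>\<^sub>M (borel \<Otimes>\<^sub>M M)"
    by (intro measurable_Pair) (auto simp: space_M)
  from measurable_compose[OF this kernel_op_measurable[OF assms]]
  show ?thesis by simp
qed

lemma subordinated_ptime:
  assumes "t > 0"
  shows "subordinated M K t f x = (1 / sqrt pi) *\<^sub>R
    (LINT s:{0<..}|lborel. (exp (- s) / sqrt s) *\<^sub>R kernel_op M (K (ptime (t / (2 * sqrt s)))) f x)"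
  unfolding subordinated_def
  using assms by (intro arg_cong[where f = "scaleR _"] set_lebesgue_integral_cong) auto

lemma subordinated_measurable:
  assumes K: "jointly_measurable M K" and f: "f \<in> borel_measurable M" and t: "t > 0"
  shows "subordinated M K t f \<in> borel_measurable M"
proof -
  have 1: "(\<lambda>z. (t / (2 * sqrt (snd z)), fst z)) \<in> (M \<Otimes>\<^sub>M lborel) \<rightarrow>\<^sub>M (borel \<Otimes>\<^sub>M M)"
    by measurable
  have [measurable]: "(\<lambda>z. kernel_op M (K (ptime (t / (2 * sqrt (snd z))))) f (fst z)) \<in> borel_measurable (M \<Otimes>\<^sub>M lborel)"
    using measurable_compose[OF 1 kernel_op_measurable[OF K f]] by simp
  show ?thesis
    unfolding subordinated_ptime[OF t, abs_def] set_lebesgue_integral_def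
    by (intro borel_measurable_scaleR borel_measurable_const
      sigma_finite_measure.borel_measurable_lebesgue_integral[OF lborel.sigma_finite_measure_axioms])
      (simp add: case_prod_beta')
qed

end

section \<open>Maximal functions\<close>

context doubling_space
begin

text \<open>By continuity in time, each value is a limit of values at rational times. These are
  taken below t, so that they stay in the downward closed set \<open>U\<close>, and above t / 2, as
  \<open>subordination_LIMSEQ\<close> requires.\<close>

lemma SUP_subordinated_rational:
  assumes K: "jointly_measurable M K" and f: "f \<in> borel_measurable M"
    and int: "\<And>t. t > 0 \<Longrightarrow> set_integrable lborel {0<..}
      (\<lambda>s. (exp (- s) / sqrt s) *\<^sub>R kernel_op M (K (ptime (t / (2 * sqrt s)))) f x)"
    and U: "U \<subseteq> {0<..}" and down: "\<And>t q. t \<in> U \<Longrightarrow> 0 < q \<Longrightarrow> q \<le> t \<Longrightarrow> q \<in> U"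
  shows "(SUP t\<in>U. ennreal (norm (subordinated M K t f x)))
    = (SUP t\<in>U \<inter> \<rat>. ennreal (norm (subordinated M K t f x)))" (is "_ = ?S")
proof (rule antisym)
  show "(SUP t\<in>U. ennreal (norm (subordinated M K t f x))) \<le> ?S"
  proof (rule SUP_least)
    fix t assume t: "t \<in> U"
    then have t0: "t > 0" using U by auto
    have "\<exists>q\<in>\<rat>. max (t / 2) (t - 1 / Suc n) < q \<and> q < t" for n
      using t0 by (intro Rats_dense_in_real) auto
    then obtain q where q: "\<And>n. q n \<in> \<rat>" "\<And>n. t / 2 < q n" "\<And>n. t - 1 / Suc n < q n" "\<And>n. q n < t"
      by (metis max_less_iff_conj)
    have q0: "q n > 0" for n using q(2)[of n] t0 by linarith
    have "q \<longlonglongrightarrow> t"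
    proof (rule tendsto_sandwich)
      show "(\<lambda>n. t - 1 / Suc n) \<longlonglongrightarrow> t"
        using tendsto_diff[OF tendsto_const LIMSEQ_inverse_real_of_nat, of t] by (simp add: inverse_eq_divide)
    qed (use q(3,4) in \<open>auto intro!: always_eventually less_imp_le simp del: of_nat_Suc\<close>)
    then have "(\<lambda>n. subordinated M K (q n) f x) \<longlonglongrightarrow> subordinated M K t f x"
      unfolding subordinated_ptime[OF t0] subordinated_ptime[OF q0]
      using q(2) t0
      by (intro tendsto_scaleR tendsto_const kernel_op_time_measurable[OF K f] int subordination_LIMSEQ
        [of "\<lambda>u. kernel_op M (K (ptime u)) f x"]) (auto intro: less_imp_le)
    then have "(\<lambda>n. ennreal (norm (subordinated M K (q n) f x))) \<longlonglongrightarrow> ennreal (norm (subordinated M K t f x))"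
      by (intro tendsto_ennrealI tendsto_norm)
    then show "ennreal (norm (subordinated M K t f x)) \<le> ?S"
    proof (rule LIMSEQ_le_const2)
      have "ennreal (norm (subordinated M K (q n) f x)) \<le> ?S" for n
        using q(1)[of n] down[OF t q0 less_imp_le[OF q(4)]] by (intro SUP_upper) auto
      then show "\<exists>N. \<forall>n\<ge>N. ennreal (norm (subordinated M K (q n) f x)) \<le> ?S" by blast
    qed
  qed
qed (rule SUP_subset_mono, auto)

lemma max_fun_measurable:
  assumes K: "jointly_measurable M K" and f: "f \<in> borel_measurable M"
    and int: "\<And>t x. t > 0 \<Longrightarrow> set_integrable lborel {0<..}
      (\<lambda>s. (exp (- s) / sqrt s) *\<^sub>R kernel_op M (K (ptime (t / (2 * sqrt s)))) f x)"
  shows "max_fun M K f \<in> borel_measurable M"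
proof -
  have "max_fun M K f = (\<lambda>x. SUP t\<in>{0<..} \<inter> \<rat>. ennreal (norm (subordinated M K t f x)))"
    unfolding max_fun_def by (intro ext SUP_subordinated_rational[OF K f int]) auto
  moreover have "(\<lambda>x. SUP t\<in>{0<..} \<inter> \<rat>. ennreal (norm (subordinated M K t f x))) \<in> borel_measurable M"
    using subordinated_measurable[OF K f]
    by (intro borel_measurable_SUP measurable_compose[OF _ measurable_ennreal] borel_measurable_norm)
       (auto intro: countable_rat countable_subset[OF Int_lower2])
  ultimately show ?thesis by simp
qed

text \<open>The range of times depends on x. Padding with 0, which does not affect the supremum,
  yields one countable index set for all x.\<close>

lemma local_max_fun_measurable:
  assumes K: "jointly_measurable M K" and f: "f \<in> borel_measurable M"
    and int: "\<And>t x. t > 0 \<Longrightarrow> set_integrable lborel {0<..}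
      (\<lambda>s. (exp (- s) / sqrt s) *\<^sub>R kernel_op M (K (ptime (t / (2 * sqrt s)))) f x)"
    and [measurable]: "\<rho> \<in> borel_measurable M"
  shows "local_max_fun M \<rho> K f \<in> borel_measurable M"
proof -
  let ?n = "\<lambda>t x. ennreal (norm (subordinated M K t f x))"
  have "local_max_fun M \<rho> K f x = (SUP t\<in>{0<..} \<inter> \<rat>. if t < \<rho> x then ?n t x else 0)" for x
  proof -
    have "local_max_fun M \<rho> K f x = (SUP t\<in>{0<..<\<rho> x} \<inter> \<rat>. ?n t x)"
      unfolding local_max_fun_def by (intro SUP_subordinated_rational[OF K f int]) auto
    also have "\<dots> = (SUP t\<in>{0<..} \<inter> \<rat>. if t < \<rho> x then ?n t x else 0)"
    proof (intro antisym SUP_least)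
      fix t :: real assume "t \<in> {0<..<\<rho> x} \<inter> \<rat>"
      then show "?n t x \<le> (SUP t\<in>{0<..} \<inter> \<rat>. if t < \<rho> x then ?n t x else 0)"
        by (intro SUP_upper2[of t]) auto
    next
      fix t :: real assume "t \<in> {0<..} \<inter> \<rat>"
      then show "(if t < \<rho> x then ?n t x else 0) \<le> (SUP t\<in>{0<..<\<rho> x} \<inter> \<rat>. ?n t x)"
        by (auto intro: SUP_upper)
    qed
    finally show ?thesis .
  qed
  moreover have "(\<lambda>x. SUP t\<in>{0<..} \<inter> \<rat>. if t < \<rho> x then ?n t x else 0) \<in> borel_measurable M"
  proof (intro borel_measurable_SUP)
    fix t :: real assume "t \<in> {0<..} \<inter> \<rat>"
    then have [measurable]: "subordinated M K t f \<in> borel_measurable M"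
      by (intro subordinated_measurable[OF K f]) auto
    show "(\<lambda>x. if t < \<rho> x then ?n t x else 0) \<in> borel_measurable M" by measurable
  qed (auto intro: countable_rat countable_subset[OF Int_lower2])
  ultimately show ?thesis by presburger
qed

end

section \<open>Subordinated functions and the maximal function of the means\<close>

context bmo
begin

lemma mean_subw:
  assumes C: "\<And>k::nat. real (Suc k) \<le> C * 2 powr (1 / 2 * real k)" and t: "t > 0" and s: "s > 0"
  shows "norm (m x (t / (2 * sqrt s)) - m x t) \<le> 2 * C * (A * b) * subw s"
proof -
  have C0: "C \<ge> 0" using C[of 0] by simp
  define u where "u = t / (2 * sqrt s)"
  have u: "u > 0" using t s by (simp add: u_def)
  have tu: "t / u = 2 * sqrt s" "u / t = 1 / (2 * sqrt s)" using t s by (auto simp: u_def field_simps)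
  have p: "(sqrt s) powr (1 / 2) = s powr (1 / 4)"
    using s by (simp add: powr_half_sqrt[symmetric] powr_powr)
  have sw: "s powr (1 / 4) \<ge> 0" "s powr (- 1 / 4) \<ge> 0" by auto
  have "norm (m x u - m x t) \<le> C * (A * b) * (2 * subw s)"
  proof (cases "u \<le> t")
    case True
    have "norm (m x u - m x t) \<le> C * (A * b) * (2 * sqrt s) powr (1 / 2)"
      using mean_powr[OF C _ u True] by (simp add: tu)
    also have "(2 * sqrt s) powr (1 / 2) = 2 powr (1 / 2) * s powr (1 / 4)"
      using s by (simp add: powr_mult p)
    also have "\<dots> \<le> 2 * subw s"
      using powr_mono[of "1 / 2" 1 "2::real"] sw by (intro mult_mono) (auto simp: subw_def)
    finally show ?thesis using C0 A_ge_1 b_pos by (simp add: mult_left_mono)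
  next
    case False
    have "norm (m x u - m x t) \<le> C * (A * b) * (1 / (2 * sqrt s)) powr (1 / 2)"
      using mean_powr[OF C _ t, of u x] False by (simp add: tu norm_minus_commute)
    also have "(1 / (2 * sqrt s)) powr (1 / 2) \<le> (1 / sqrt s) powr (1 / 2)"
      using s by (intro powr_mono2) (auto simp: field_simps)
    also have "(1 / sqrt s) powr (1 / 2) = s powr (- 1 / 4)"
      using s by (simp add: powr_divide p powr_minus_divide)
    also have "\<dots> \<le> 2 * subw s"
      using sw by (simp add: subw_def)
    finally show ?thesis using C0 A_ge_1 b_pos by (simp add: mult_left_mono)
  qed
  then show ?thesis by (simp add: u_def ac_simps)
qed

lemma subordinated_near_mean:
  assumes C: "\<And>k::nat. real (Suc k) \<le> C * 2 powr (1 / 2 * real k)"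
    and K: "jointly_measurable M K"
    and near: "\<And>u. u > 0 \<Longrightarrow> norm (kernel_op M (K u) f x - m x u) \<le> e" and t: "t > 0"
  shows "set_integrable lborel {0<..}
      (\<lambda>s. (exp (- s) / sqrt s) *\<^sub>R kernel_op M (K (ptime (t / (2 * sqrt s)))) f x)"
    "norm (subordinated M K t f x - m x t) \<le> (e + 2 * C * (A * b)) * subc"
proof -
  let ?H = "\<lambda>s. kernel_op M (K (ptime (t / (2 * sqrt s)))) f x"
  have C0: "C \<ge> 0" using C[of 0] by simp
  have e0: "e \<ge> 0" using order_trans[OF norm_ge_zero near[of 1]] by simp
  have E0: "e + 2 * C * (A * b) \<ge> 0" using e0 C0 A_ge_1 b_pos by simp
  have [measurable]: "?H \<in> borel_measurable borel"
    by (rule measurable_compose[OF _ kernel_op_time_measurable[OF K f_meas]]) measurable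
  have H: "norm (?H s - m x t) \<le> (e + 2 * C * (A * b)) * subw s" if s: "s > 0" for s
  proof -
    have u: "t / (2 * sqrt s) > 0" using t s by simp
    have "1 \<le> subw s" by (simp add: subw_def)
    then have "e \<le> e * subw s" using e0 mult_left_mono[of 1 "subw s" e] by simp
    moreover have "norm (?H s - m x t) \<le> norm (?H s - m x (t / (2 * sqrt s))) + norm (m x (t / (2 * sqrt s)) - m x t)"
      using norm_triangle_ineq[of "?H s - m x (t / (2 * sqrt s))" "m x (t / (2 * sqrt s)) - m x t"] by simp
    ultimately show ?thesis
      using near[OF u] mean_subw[OF C t s, of x] u by (simp add: distrib_right)
  qed
  show "set_integrable lborel {0<..} (\<lambda>s. (exp (- s) / sqrt s) *\<^sub>R ?H s)"
    by (rule subordination(1)[OF _ E0 H]) measurable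
  show "norm (subordinated M K t f x - m x t) \<le> (e + 2 * C * (A * b)) * subc"
    unfolding subordinated_ptime[OF t]
    by (rule subordination(2)[OF _ E0 H]) measurable
qed

definition mean_max :: "'a \<Rightarrow> ennreal" where
  "mean_max x = (SUP t\<in>{0<..}. ennreal (norm (m x t)))"

definition far_max :: "'a \<Rightarrow> real \<Rightarrow> ennreal" where
  "far_max z r = (SUP t\<in>{r..}. ennreal (norm (m z t)))"

text \<open>For t < r the distance of \<open>m x t\<close> from \<open>m z r\<close> is at most an
  average of the deviation from \<open>m z r\<close>; for t \<ge> r the points x and z are within t
  of each other and \<open>mean_shift\<close> applies.\<close>

lemma mean_max_le_far:
  assumes r: "r > 0" and x: "dist z x < r"
  shows "mean_max x \<le> far_max z r + ennreal A * loc_max z r x + ennreal (2 * A\<^sup>2 * b)"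
  unfolding mean_max_def
proof (rule SUP_least)
  fix t :: real assume "t \<in> {0<..}"
  then have t: "t > 0" by simp
  show "ennreal (norm (m x t)) \<le> far_max z r + ennreal A * loc_max z r x + ennreal (2 * A\<^sup>2 * b)"
  proof (cases "t < r")
    case True
    have "ennreal (norm (m x t)) \<le> ennreal (norm (m z r)) + ennreal (norm (m x t - m z r))"
      using norm_triangle_ineq[of "m z r" "m x t - m z r"] by (simp flip: ennreal_plus)
    also have "\<dots> \<le> far_max z r + ennreal A * loc_max z r x"
    proof (intro add_mono)
      show "ennreal (norm (m z r)) \<le> far_max z r"
        unfolding far_max_def by (intro SUP_upper) simp
      show "ennreal (norm (m x t - m z r)) \<le> ennreal A * loc_max z r x"
        using norm_mean_diff_le[OF f_loc t] avg_le_loc_max[OF t, of r z x] True order_trans by fastforce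
    qed
    finally show ?thesis by (simp add: add_increasing2)
  next
    case False
    have "norm (m x t) \<le> norm (m z t) + 2 * A\<^sup>2 * b"
      using mean_shift[OF t, of x z] x False norm_triangle_ineq[of "m z t" "m x t - m z t"]
      by (simp add: dist_commute)
    then have "ennreal (norm (m x t)) \<le> ennreal (norm (m z t)) + ennreal (2 * A\<^sup>2 * b)"
      using b_pos by (simp flip: ennreal_plus)
    also have "\<dots> \<le> far_max z r + ennreal (2 * A\<^sup>2 * b)"
      unfolding far_max_def using False by (intro add_right_mono SUP_upper) simp
    also have "\<dots> \<le> far_max z r + ennreal A * loc_max z r x + ennreal (2 * A\<^sup>2 * b)"
      by (intro add_right_mono) (simp add: add_increasing2)
    finally show ?thesis .
  qed
qed

lemma far_max_le_mean_max:
  assumes r: "r > 0" and y: "dist z y < r"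
  shows "far_max z r \<le> mean_max y + ennreal (2 * A\<^sup>2 * b)"
  unfolding far_max_def
proof (rule SUP_least)
  fix t :: real assume "t \<in> {r..}"
  then have t: "t > 0" "dist z y \<le> t" using r y by auto
  have "norm (m z t) \<le> norm (m y t) + 2 * A\<^sup>2 * b"
    using mean_shift[OF t] norm_triangle_ineq[of "m y t" "m z t - m y t"] by simp
  then have "ennreal (norm (m z t)) \<le> ennreal (norm (m y t)) + ennreal (2 * A\<^sup>2 * b)"
    using b_pos by (simp flip: ennreal_plus)
  also have "\<dots> \<le> mean_max y + ennreal (2 * A\<^sup>2 * b)"
    unfolding mean_max_def using t by (intro add_right_mono SUP_upper) simp
  finally show "ennreal (norm (m z t)) \<le> mean_max y + ennreal (2 * A\<^sup>2 * b)" .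
qed

end

lemma ennreal_enn2real_le: "ennreal (enn2real x) \<le> x"
  by (simp add: ennreal_enn2real_if)

section \<open>BLO bounds for the maximal functions\<close>

context bmo_rho
begin

lemma far_max_large: "r \<ge> \<rho> z \<Longrightarrow> far_max z r \<le> ennreal b"
  unfolding far_max_def by (intro SUP_least ennreal_leI norm_mean_large) auto

text \<open>Only the two-sided comparison with \<open>mean_max\<close> enters, so the same estimate
  serves every maximal function. Balls in the collection come first: their averages give finiteness
  almost everywhere, local integrability and finiteness of \<open>far_max\<close>, on which the
  essential infimum bound rests.\<close>

lemma BLO_of_near_mean_max:
  assumes g [measurable]: "g \<in> borel_measurable M" and e: "e \<ge> 0"
    and g1: "\<And>x. g x \<le> mean_max x + ennreal e" and g2: "\<And>x. mean_max x \<le> g x + ennreal e"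
  shows "in_BLO M \<rho> g" "ext_BLO_norm M \<rho> g \<le> ennreal (16 * A * L + 12 * A\<^sup>2 * b + 12 * e + b)"
proof -
  define E where "E = 2 * A\<^sup>2 * b + e"
  have E0: "E \<ge> 0" using e b_pos by (simp add: E_def)
  have E: "ennreal (2 * A\<^sup>2 * b) + ennreal e = ennreal E"
    using e b_pos by (simp add: E_def)
  let ?H = "\<lambda>z r x. ennreal A * loc_max z r x"
  have avgH: "avg (?H z r) z r \<le> ennreal (2 * A * L)" if "r > 0" for z r
  proof -
    have "avg (?H z r) z r \<le> ennreal A * ennreal (2 * L)"
      by (subst avg_cmult, measurable) (rule mult_left_mono[OF avg_loc_max[OF that] zero_le])
    also have "\<dots> = ennreal (2 * A * L)"
      using A_ge_1 b_pos by (subst ennreal_mult[symmetric]) (auto simp: ac_simps)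
    finally show ?thesis .
  qed
  have up: "g x \<le> far_max z r + ?H z r x + ennreal E" if "r > 0" "dist z x < r" for x z r
    using order_trans[OF g1[of x] add_right_mono[OF mean_max_le_far[OF that]]]
    by (simp add: E[symmetric] add.assoc)
  have low: "far_max z r \<le> g y + ennreal E" if "r > 0" "dist z y < r" for y z r
    using order_trans[OF far_max_le_mean_max[OF that] add_right_mono[OF g2]]
    by (simp add: E[symmetric] ac_simps)
  have avg_large: "avg g z r \<le> ennreal (b + 2 * A * L + E)" if r: "r \<ge> \<rho> z" for z r
  proof -
    have r0: "r > 0" using \<rho>_pos[of z] r by linarith
    have "avg g z r \<le> avg (\<lambda>x. ennreal (b + E) + ?H z r x) z r"
    proof (rule avg_mono)
      fix x assume "dist z x < r"
      from up[OF r0 this] have "g x \<le> ennreal b + ?H z r x + ennreal E"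
        using far_max_large[OF r] by (meson add_right_mono order_trans)
      then show "g x \<le> ennreal (b + E) + ?H z r x"
        using b_pos E0 by (simp add: ac_simps)
    qed
    also have "\<dots> = ennreal (b + E) + avg (?H z r) z r"
      using r0 by (subst avg_add) (auto simp: avg_const)
    also have "\<dots> \<le> ennreal (b + E) + ennreal (2 * A * L)"
      by (intro add_left_mono avgH r0)
    also have "\<dots> = ennreal (b + 2 * A * L + E)"
      using b_pos E0 A_ge_1 by (subst ennreal_plus[symmetric]) (auto simp: ac_simps)
    finally show ?thesis .
  qed
  have fin: "(\<integral>\<^sup>+x\<in>ball z r. g x \<partial>M) < top" if r: "r > 0" for z r
  proof -
    \<comment> \<open>A small ball is enlarged until it belongs to the collection, where the average
      is already bounded.\<close>
    let ?R = "max r (\<rho> z)"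
    have "(\<integral>\<^sup>+x\<in>ball z r. g x \<partial>M) \<le> (\<integral>\<^sup>+x\<in>ball z ?R. g x \<partial>M)"
      by (intro nn_integral_mono) (auto simp: indicator_def)
    also have "\<dots> = avg g z ?R * emeasure M (ball z ?R)"
      using r by (subst avg_mult) auto
    also have "\<dots> < top"
      using avg_large[of z ?R] ball_fin
      by (intro ennreal_mult_less_top[THEN iffD2]) (auto intro: le_less_trans)
    finally show ?thesis .
  qed
  have AE_fin: "AE x in M. g x < top"
  proof -
    have "AE x in M. \<forall>n. x \<in> ball undefined (real (Suc n)) \<longrightarrow> g x \<noteq> top"
    proof (subst AE_all_countable, rule allI)
      fix n
      have "AE x in M. g x * indicator (ball undefined (real (Suc n))) x \<noteq> \<infinity>"
        using fin[of "real (Suc n)" undefined] by (intro nn_integral_noteq_infinite) auto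
      then show "AE x in M. x \<in> ball undefined (real (Suc n)) \<longrightarrow> g x \<noteq> top"
        by eventually_elim (auto simp: indicator_def)
    qed
    then show ?thesis
    proof eventually_elim
      case (elim x)
      obtain n where "dist undefined x < real n" using reals_Archimedean2 by blast
      then have "x \<in> ball undefined (real (Suc n))" by simp
      then show ?case using elim by (auto simp: less_top)
    qed
  qed
  have loc: "(\<lambda>x. enn2real (g x)) \<in> L1_loc M"
    unfolding L1_loc_def set_integrable_def
  proof (safe, rule integrableI_bounded)
    fix z :: 'a and r :: real assume r: "r > 0"
    have "(\<integral>\<^sup>+x. ennreal (norm (indicator (ball z r) x *\<^sub>R enn2real (g x))) \<partial>M) \<le> (\<integral>\<^sup>+x\<in>ball z r. g x \<partial>M)"
      by (intro nn_integral_mono) (auto simp: indicator_def ennreal_enn2real_le)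
    also note fin[OF r]
    finally show "(\<integral>\<^sup>+x. ennreal (norm (indicator (ball z r) x *\<^sub>R enn2real (g x))) \<partial>M) < \<infinity>" by simp
  qed measurable
  have large_le: "sup_large_balls M \<rho> (\<lambda>x. enn2real (g x)) \<le> ennreal (b + 2 * A * L + E)"
    unfolding sup_large_balls_def
  proof (rule SUP_least, clarify)
    fix z r assume "\<rho> z \<le> r"
    have "avg (\<lambda>y. ennreal (norm (enn2real (g y)))) z r \<le> avg g z r"
      by (intro avg_mono) (auto simp: ennreal_enn2real_le)
    also note avg_large[OF \<open>\<rho> z \<le> r\<close>]
    finally show "(\<integral>\<^sup>+y\<in>ball z r. ennreal (norm (enn2real (g y))) \<partial>M) / emeasure M (ball z r)
        \<le> ennreal (b + 2 * A * L + E)"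
      by (simp only: avg_def)
  qed
  have small_le: "(\<integral>\<^sup>+y\<in>ball z r. e2ennreal (ereal (enn2real (g y)) - ess_inf_on M (ball z r) (\<lambda>x. enn2real (g x))) \<partial>M)
      / emeasure M (ball z r) \<le> ennreal (2 * A * L + 2 * E)" if r: "r > 0" for z r
  proof -
    let ?f = "\<lambda>x. enn2real (g x)"
    \<comment> \<open>\<open>far_max z r\<close> is a constant that lies below g + E on the whole
      ball, so averaging over the ball shows that it is finite.\<close>
    have "far_max z r = avg (\<lambda>y. far_max z r) z r" using r by (simp add: avg_const)
    also have "\<dots> \<le> avg (\<lambda>y. g y + ennreal E) z r" by (intro avg_mono low r)
    also have "\<dots> = avg g z r + ennreal E" using r by (subst avg_add) (auto simp: avg_const)
    also have "\<dots> < top"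
      using fin[OF r, of z] ball_pos[OF r, of z] unfolding avg_def
      by (auto simp: ennreal_divide_eq_top_iff less_top[symmetric])
    finally obtain \<nu> where \<nu>: "far_max z r = ennreal \<nu>" "\<nu> \<ge> 0" by (cases "far_max z r") auto
    have "esssup (restrict_space M (ball z r)) (\<lambda>y. - ereal (?f y)) \<le> - ereal (\<nu> - E)"
    proof (rule esssup_I)
      show "(\<lambda>y. - ereal (?f y)) \<in> borel_measurable (restrict_space M (ball z r))"
        by (intro measurable_restrict_space1) measurable
      \<comment> \<open>\<open>enn2real\<close> sends an infinite value of g to 0, so the lower
        bound is claimed only almost everywhere, which is enough for an essential infimum.\<close>
      show "AE y in restrict_space M (ball z r). - ereal (?f y) \<le> - ereal (\<nu> - E)"
      proof (subst AE_restrict_space_iff)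
        show "AE y in M. y \<in> ball z r \<longrightarrow> - ereal (?f y) \<le> - ereal (\<nu> - E)"
          using AE_fin
        proof eventually_elim
          case (elim y)
          have "- ?f y \<le> E - \<nu>" if "dist z y < r"
          proof -
            have "ennreal \<nu> \<le> ennreal (?f y) + ennreal E"
              using low[OF r that] elim by (simp add: \<nu>)
            then show ?thesis using E0 by (simp flip: ennreal_plus)
          qed
          then show ?case by simp
        qed
      qed simp
    qed
    then have inf: "ereal (\<nu> - E) \<le> ess_inf_on M (ball z r) ?f"
      unfolding ess_inf_on_def by (metis ereal_minus_le_minus ereal_uminus_uminus)
    have "avg (\<lambda>y. e2ennreal (ereal (?f y) - ess_inf_on M (ball z r) ?f)) z r
        \<le> avg (\<lambda>y. ennreal (2 * E) + ?H z r y) z r"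
    proof (rule avg_mono)
      fix y assume y: "dist z y < r"
      have "e2ennreal (ereal (?f y) - ess_inf_on M (ball z r) ?f) \<le> e2ennreal (ereal (?f y) - ereal (\<nu> - E))"
        by (intro e2ennreal_mono ereal_minus_mono inf) simp
      also have "\<dots> = ennreal (?f y - (\<nu> - E))" by simp
      also have "\<dots> \<le> ennreal (2 * E) + ?H z r y"
      \<comment> \<open>The local maximal function may be infinite at y; the bound is then
        trivial.\<close>
      proof (cases "?H z r y")
        case (real h)
        have "ennreal (?f y) \<le> ennreal (\<nu> + h + E)"
          using order_trans[OF ennreal_enn2real_le up[OF r y]] \<nu> real E0 by simp
        then have "?f y \<le> \<nu> + h + E"
          using \<nu> real E0 by (subst (asm) ennreal_le_iff) auto
        then have "ennreal (?f y - (\<nu> - E)) \<le> ennreal (2 * E + h)"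
          by (intro ennreal_leI) simp
        then show ?thesis using real E0 by simp
      qed simp
      finally show "e2ennreal (ereal (?f y) - ess_inf_on M (ball z r) ?f) \<le> ennreal (2 * E) + ?H z r y" .
    qed
    also have "\<dots> = ennreal (2 * E) + avg (?H z r) z r"
      using r by (subst avg_add) (auto simp: avg_const)
    also have "\<dots> \<le> ennreal (2 * E) + ennreal (2 * A * L)"
      by (intro add_left_mono avgH r)
    also have "\<dots> = ennreal (2 * A * L + 2 * E)"
      using b_pos E0 A_ge_1 by (subst ennreal_plus[symmetric]) (auto simp: ac_simps)
    finally show ?thesis by (simp only: avg_def)
  qed
  have "BLO_norm M \<rho> (\<lambda>x. enn2real (g x)) \<le> ennreal (2 * A * L + 2 * E) + ennreal (b + 2 * A * L + E)"
    unfolding BLO_norm_def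
    by (intro add_mono large_le SUP_least) (simp only: mem_Collect_eq split: prod.splits, blast intro: small_le)
  also have "\<dots> = ennreal ((2 * A * L + 2 * E) + (b + 2 * A * L + E))"
    using b_pos E0 A_ge_1 by (subst ennreal_plus[symmetric]) auto
  \<comment> \<open>The left side equals 4 A L + 6 A^2 b + 3 e + b, so the constants on the right
    leave room.\<close>
  also have "\<dots> \<le> ennreal (16 * A * L + 12 * A\<^sup>2 * b + 12 * e + b)"
    using b_pos A_ge_1 e by (intro ennreal_leI) (simp add: E_def)
  finally have le: "BLO_norm M \<rho> (\<lambda>x. enn2real (g x)) \<le> ennreal (16 * A * L + 12 * A\<^sup>2 * b + 12 * e + b)" .
  show "ext_BLO_norm M \<rho> g \<le> ennreal (16 * A * L + 12 * A\<^sup>2 * b + 12 * e + b)"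
    unfolding ext_BLO_norm_def by (rule le)
  show "in_BLO M \<rho> g"
    using AE_fin loc le by (auto simp: in_BLO_def BLO_def intro: le_less_trans)
qed

end

context bmo_rho
begin

text \<open>The local maximal function ignores times t \<ge> \<rho> x, but there the means are
  bounded by \<open>b\<close>; this is the origin of \<open>b\<close> in the error
  \<open>e + b\<close>.\<close>

lemma max_fun_near_mean_max:
  assumes e: "\<And>t. t > 0 \<Longrightarrow> norm (subordinated M K t f x - m x t) \<le> e"
  shows "max_fun M K f x \<le> mean_max x + ennreal (e + b)"
    "mean_max x \<le> max_fun M K f x + ennreal (e + b)"
    "local_max_fun M \<rho> K f x \<le> mean_max x + ennreal (e + b)"
    "mean_max x \<le> local_max_fun M \<rho> K f x + ennreal (e + b)"
proof -
  let ?P = "\<lambda>t. subordinated M K t f x"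
  have e0: "e \<ge> 0" using order_trans[OF norm_ge_zero e[of 1]] by simp
  have 1: "ennreal (norm (?P t)) \<le> mean_max x + ennreal (e + b)" if "t > 0" for t
  proof -
    have "norm (?P t) \<le> norm (m x t) + (e + b)"
      using e[OF that] norm_triangle_ineq[of "m x t" "?P t - m x t"] b_pos by simp
    then have "ennreal (norm (?P t)) \<le> ennreal (norm (m x t)) + ennreal (e + b)"
      using e0 b_pos ennreal_leI by (simp only: ennreal_plus[symmetric] norm_ge_zero add_nonneg_nonneg less_imp_le)
    also have "\<dots> \<le> mean_max x + ennreal (e + b)"
      unfolding mean_max_def using that by (intro add_right_mono SUP_upper) simp
    finally show ?thesis .
  qed
  have 2: "ennreal (norm (m x t)) \<le> ennreal (norm (?P t)) + ennreal (e + b)" if "t > 0" for t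
  proof -
    have "norm (m x t) \<le> norm (?P t) + (e + b)"
      using e[OF that] norm_triangle_ineq4[of "?P t" "?P t - m x t"] b_pos by simp
    then show ?thesis
      using e0 b_pos ennreal_leI by (simp only: ennreal_plus[symmetric] norm_ge_zero add_nonneg_nonneg less_imp_le)
  qed
  show "max_fun M K f x \<le> mean_max x + ennreal (e + b)"
    unfolding max_fun_def by (intro SUP_least 1) simp
  show "local_max_fun M \<rho> K f x \<le> mean_max x + ennreal (e + b)"
    unfolding local_max_fun_def by (intro SUP_least 1) simp
  have le: "local_max_fun M \<rho> K f x \<le> max_fun M K f x"
    unfolding local_max_fun_def max_fun_def by (intro SUP_subset_mono) auto
  show loc: "mean_max x \<le> local_max_fun M \<rho> K f x + ennreal (e + b)"
    unfolding mean_max_def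
  proof (rule SUP_least)
    fix t :: real assume "t \<in> {0<..}"
    then have t: "t > 0" by simp
    show "ennreal (norm (m x t)) \<le> local_max_fun M \<rho> K f x + ennreal (e + b)"
    proof (cases "t < \<rho> x")
      case True
      then show ?thesis
        using t unfolding local_max_fun_def
        by (intro order_trans[OF 2[OF t]] add_right_mono SUP_upper) simp
    next
      case False
      then have "ennreal (norm (m x t)) \<le> ennreal (e + b)"
        using norm_mean_large[of x t] e0 by (intro ennreal_leI) simp
      then show ?thesis by (simp add: add_increasing)
    qed
  qed
  show "mean_max x \<le> max_fun M K f x + ennreal (e + b)"
    by (rule order_trans[OF loc add_right_mono[OF le]])
qed

lemma max_fun_BLO:
  assumes C: "\<And>k::nat. real (Suc k) \<le> C * 2 powr (1 / 2 * real k)"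
    and K: "jointly_measurable M K" and \<rho>_meas: "\<rho> \<in> borel_measurable M"
    and near: "\<And>u x. u > 0 \<Longrightarrow> norm (kernel_op M (K u) f x - m x u) \<le> e"
  defines "W \<equiv> ennreal (16 * A * L + 12 * A\<^sup>2 * b + 12 * ((e + 2 * C * (A * b)) * subc + b) + b)"
  shows "in_BLO M \<rho> (max_fun M K f)" "ext_BLO_norm M \<rho> (max_fun M K f) \<le> W"
    "in_BLO M \<rho> (local_max_fun M \<rho> K f)" "ext_BLO_norm M \<rho> (local_max_fun M \<rho> K f) \<le> W"
proof -
  note int = subordinated_near_mean(1)[OF C K near]
  note P = subordinated_near_mean(2)[OF C K near]
  have nonneg: "0 \<le> (e + 2 * C * (A * b)) * subc + b"
    using order_trans[OF norm_ge_zero P[of 1]] b_pos by simp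
  have meas: "max_fun M K f \<in> borel_measurable M" "local_max_fun M \<rho> K f \<in> borel_measurable M"
    by (rule max_fun_measurable[OF K f_meas int] local_max_fun_measurable[OF K f_meas int \<rho>_meas]; assumption)+
  show "in_BLO M \<rho> (max_fun M K f)" "ext_BLO_norm M \<rho> (max_fun M K f) \<le> W"
    unfolding W_def
    by (rule BLO_of_near_mean_max[OF meas(1) nonneg max_fun_near_mean_max(1,2)[OF P]]; assumption)+
  show "in_BLO M \<rho> (local_max_fun M \<rho> K f)" "ext_BLO_norm M \<rho> (local_max_fun M \<rho> K f) \<le> W"
    unfolding W_def
    by (rule BLO_of_near_mean_max[OF meas(2) nonneg max_fun_near_mean_max(3,4)[OF P]]; assumption)+
qed

end

section \<open>From the stated hypotheses to the constant of the theorem\<close>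

context doubling_space
begin

text \<open>On balls of the collection the norm controls averages of |f| only; subtracting the mean
  there at most doubles the bound, hence \<open>2 * b\<close>.\<close>

lemma bmo_rho_of_BMO:
  fixes f :: "'a \<Rightarrow> complex"
  assumes f: "f \<in> BMO M \<rho>" and le: "BMO_norm M \<rho> f \<le> ennreal b" and b: "b > 0"
    and \<rho>: "\<And>x. \<rho> x > 0"
  shows "bmo_rho M A f (2 * b) \<rho>"
proof -
  have loc: "f \<in> L1_loc M" using f by (simp add: BMO_def)
  have [measurable]: "f \<in> borel_measurable M" using loc by (rule L1_loc_measurable)
  have large: "avg (\<lambda>y. ennreal (norm (f y))) x r \<le> ennreal b" if "r \<ge> \<rho> x" for x r
  proof -
    have "avg (\<lambda>y. ennreal (norm (f y))) x r \<le> sup_large_balls M \<rho> f"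
      unfolding sup_large_balls_def avg_def
      using that \<rho>[of x] by (intro SUP_upper2[of "(x, r)"]) auto
    also have "\<dots> \<le> BMO_norm M \<rho> f" by (simp add: BMO_norm_def add_increasing)
    finally show ?thesis using le by simp
  qed
  show ?thesis
  proof unfold_locales
    show "f \<in> L1_loc M" by (rule loc)
    show "0 < 2 * b" using b by simp
    show "\<rho> x > 0" for x by (rule \<rho>)
    show "avg (\<lambda>y. ennreal (norm (f y))) x r \<le> ennreal (2 * b)" if "r \<ge> \<rho> x" for x r
      using order_trans[OF large[OF that] ennreal_leI[of b "2 * b"]] b by simp
    show "avg (\<lambda>y. ennreal (norm (f y - mean M (ball x r) f))) x r \<le> ennreal (2 * b)"
      if r: "r > 0" for x r
    proof (cases "r < \<rho> x")
      case True
      have "avg (\<lambda>y. ennreal (norm (f y - mean M (ball x r) f))) x r \<le> BMO_norm M \<rho> f"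
        unfolding BMO_norm_def avg_def
        using True r by (intro add_increasing2 SUP_upper2[of "(x, r)"]) auto
      also have "\<dots> \<le> ennreal (2 * b)" using b by (intro order_trans[OF le] ennreal_leI) simp
      finally show ?thesis .
    next
      case False
      let ?c = "mean M (ball x r) f"
      have "ennreal (norm ?c) \<le> avg (\<lambda>y. ennreal (norm (f y))) x r"
        using norm_mean_diff_le[OF loc r, of x 0] by simp
      then have c: "ennreal (norm ?c) \<le> ennreal b" using large[of x r] False by simp
      have "avg (\<lambda>y. ennreal (norm (f y - ?c))) x r \<le> avg (\<lambda>y. ennreal (norm (f y)) + ennreal (norm ?c)) x r"
        by (intro avg_mono) (simp flip: ennreal_plus add: norm_triangle_ineq4)
      also have "\<dots> = avg (\<lambda>y. ennreal (norm (f y))) x r + ennreal (norm ?c)"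
        using r by (subst avg_add) (auto simp: avg_const)
      also have "\<dots> \<le> ennreal b + ennreal b"
        using large[of x r] False by (intro add_mono c) simp
      finally show ?thesis using b by (simp flip: ennreal_plus)
    qed
  qed
qed

end

lemma doubling_space_of_RD_space:
  assumes "RD_space M"
  obtains A where "doubling_space M A"
proof -
  from assms obtain A where A: "A \<ge> 1" "\<And>x r. r > 0 \<Longrightarrow> vol M (2 * r) x \<le> A * vol M r x"
    unfolding RD_space_def by blast
  have reg: "space M = UNIV" "sets borel \<subseteq> sets M"
    using assms by (auto simp: RD_space_def regular_borel_measure_def)
  have ball: "0 < emeasure M (ball x r)" "emeasure M (ball x r) < top" if "r > 0" for x r
    using assms that by (auto simp: RD_space_def)
  have fin: "emeasure M (ball x r) < top" for x r
    using ball(2)[of r x] by (cases "r > 0") (auto simp: not_less ball_empty)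
  have "doubling_space M A"
  proof
    show "emeasure M (ball x (2 * r)) \<le> ennreal A * emeasure M (ball x r)" if "r > 0" for x r
      using A(2)[OF that, of x] A(1) fin
      by (simp add: vol_def emeasure_eq_ennreal_measure less_top[symmetric] flip: ennreal_mult'')
  qed (use reg ball fin A in auto)
  then show thesis by (rule that)
qed

theorem theorem5p2:
  fixes M :: "'a::metric_space measure"
    and \<rho> :: "'a \<Rightarrow> real"
    and T T' :: "real \<Rightarrow> 'a \<Rightarrow> 'a \<Rightarrow> complex"
    and C1 \<epsilon>1 \<epsilon>2 \<delta> \<gamma> :: real
  assumes "RD_space M"
    and "admissible \<rho>"
    and "\<rho> \<in> borel_measurable M"
    and "0 < C1" and "0 < \<epsilon>1" and "\<epsilon>1 \<le> 1" and "0 < \<epsilon>2"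
    and "0 < \<delta>" and "\<delta> \<le> 1" and "0 < \<gamma>"
    and "\<forall>t>0. bounded_integral_operator M (T t)"
    and "continuous_ati M \<epsilon>1 \<epsilon>2 T'"
    and "jointly_measurable M T" and "jointly_measurable M T'"
    and "\<forall>t>0. \<forall>x y. norm (T t x y - T' t x y) \<le>
           C1 * (t / (t + \<rho> x)) powr \<delta> * (1 / (vol M t x + vol2 M x y))
              * (t / (t + dist x y)) powr \<gamma>"
  shows "\<exists>C::real. C > 0 \<and> (\<forall>f \<in> BMO M \<rho>.
           in_BLO M \<rho> (max_fun M T f) \<and>
           in_BLO M \<rho> (max_fun M T' f) \<and>
           in_BLO M \<rho> (local_max_fun M \<rho> T' f) \<and>
           ext_BLO_norm M \<rho> (max_fun M T f) + ext_BLO_norm M \<rho> (max_fun M T' f)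
             + ext_BLO_norm M \<rho> (local_max_fun M \<rho> T' f)
           \<le> ennreal C * BMO_norm M \<rho> f)"
proof -
  obtain A where "doubling_space M A" using doubling_space_of_RD_space[OF assms(1)] by blast
  then interpret doubling_space M A .
  have \<rho>: "\<rho> x > 0" for x using assms(2) by (simp add: admissible_def)
  note ati = assms(12)[unfolded continuous_ati_def]
  obtain A4 where A4: "A4 > 0"
    and A4_bounds: "\<forall>t>0. (\<forall>x y. norm (T' t x y) \<le> A4 * ati_bound M \<epsilon>2 t x y) \<and>
      ati_regular M \<epsilon>1 \<epsilon>2 A4 t (T' t) \<and> ati_regular M \<epsilon>1 \<epsilon>2 A4 t (\<lambda>x y. T' t y x)"
    using ati[THEN conjunct2, THEN conjunct1] by (elim exE conjE) (rule that)
  have size: "norm (T' t x y) \<le> A4 * ati_bound M \<epsilon>2 t x y" if "t > 0" for t x y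
    using A4_bounds[THEN spec, THEN mp, OF that] by simp
  have T'_int: "integrable M (T' t x)" and T'_one: "(LINT z|M. T' t x z) = 1" if "t > 0" for t x
    using ati[THEN conjunct2, THEN conjunct2, THEN conjunct1, THEN spec, THEN mp, OF that] by simp_all
  obtain c\<delta> where c\<delta>: "c\<delta> \<ge> 1" "\<And>k::nat. real (Suc k) \<le> c\<delta> * 2 powr (\<delta> * real k)"
    using Suc_le_powr[OF assms(8)] by blast
  obtain c where c: "c \<ge> 1" "\<And>k::nat. real (Suc k) \<le> c * 2 powr (1 / 2 * real k)"
    using Suc_le_powr[of "1 / 2"] by auto
  have size': "norm (T' t x y) \<le> A4 * (1 / (vol M t x + vol2 M x y)) * (t / (t + dist x y)) powr \<epsilon>2"
    if t: "t > 0" for t x y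
  proof -
    have V: "vol M t x > 0" unfolding vol_def by (rule measure_ball_pos[OF t])
    have "ati_bound M \<epsilon>2 t x y
        = 1 / (vol M t x + vol M t y + vol2 M x y) * (t / (t + dist x y)) powr \<epsilon>2"
      using t by (simp add: ati_bound_def powr_divide)
    \<comment> \<open>Dropping the volume at y gives the shape of bound that
      \<open>kernel_near_mean\<close> expects, with decay exponent \<epsilon>2.\<close>
    also have "\<dots> \<le> 1 / (vol M t x + vol2 M x y) * (t / (t + dist x y)) powr \<epsilon>2"
      using V by (intro mult_right_mono divide_left_mono)
        (auto simp: vol_def vol2_def intro!: mult_pos_pos add_pos_nonneg)
    finally have "A4 * ati_bound M \<epsilon>2 t x y \<le> A4 * (1 / (vol M t x + vol2 M x y) * (t / (t + dist x y)) powr \<epsilon>2)"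
      using A4 by (intro mult_left_mono) auto
    then show ?thesis using size[OF t, of x y] by (simp add: mult.assoc)
  qed
  \<comment> \<open>Distance of the operators from the means per unit of the locale bound: the first
    summand comes from \<open>kernel_near_mean\<close>, the second from
    \<open>kernel_perturbation\<close>.\<close>
  define e where "e = kc A4 \<epsilon>2 * A + kc C1 \<gamma> * ((2 + c\<delta>) * A)"
  have kc0: "kc A4 \<epsilon>2 \<ge> 0" "kc C1 \<gamma> \<ge> 0"
    using A4 A_ge_1 assms(4) ksum_nonneg[OF assms(7)] ksum_nonneg[OF assms(10)] by (auto simp: kc_def)
  have e0: "e \<ge> 0" using kc0 A_ge_1 c\<delta>(1) by (simp add: e_def)
  \<comment> \<open>The bound of \<open>max_fun_BLO\<close> per unit of the locale bound, which is
    \<open>2 * b\<close>; with \<open>L\<close> written out, 16 A L gives 64 A^4. Three functions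
    then add up to 6 W b.\<close>
  define W where "W = 64 * A ^ 4 + 12 * A\<^sup>2 + 12 * ((e + 2 * c * A) * subc + 1) + 1"
  have W1: "W \<ge> 1" using A_ge_1 e0 c(1) subc_ge_1 by (simp add: W_def)
  have main: "in_BLO M \<rho> (max_fun M T f) \<and> in_BLO M \<rho> (max_fun M T' f) \<and>
      in_BLO M \<rho> (local_max_fun M \<rho> T' f) \<and>
      ext_BLO_norm M \<rho> (max_fun M T f) + ext_BLO_norm M \<rho> (max_fun M T' f)
        + ext_BLO_norm M \<rho> (local_max_fun M \<rho> T' f) \<le> ennreal (6 * W * b)"
    if f: "f \<in> BMO M \<rho>" and le: "BMO_norm M \<rho> f \<le> ennreal b" and b: "b > 0" for f b
  proof -
    interpret bmo_rho M A f "2 * b" \<rho> by (rule bmo_rho_of_BMO[OF f le b \<rho>])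
    have near': "norm (kernel_op M (T' u) f x - m x u) \<le> kc A4 \<epsilon>2 * (A * (2 * b))"
      and int': "integrable M (\<lambda>y. T' u x y * f y)" if u: "u > 0" for u x
      using kernel_near_mean[where K = "T' u", OF u assms(7) less_imp_le[OF A4] size'[OF u] T'_int[OF u] T'_one[OF u]]
      by auto
    have pert: "norm (kernel_op M (T u) f x - kernel_op M (T' u) f x) \<le> kc C1 \<gamma> * ((2 + c\<delta>) * (A * (2 * b)))"
      if u: "u > 0" for u x
      using assms(15) u
      by (intro kernel_perturbation(2)[OF c\<delta>(2) assms(8) u assms(10) less_imp_le[OF assms(4)] _
        kernel_measurable[OF assms(13) u] kernel_measurable[OF assms(14) u] int'[OF u]]) blast
    have nT': "norm (kernel_op M (T' u) f x - m x u) \<le> e * (2 * b)" if u: "u > 0" for u x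
    proof -
      have "0 \<le> kc C1 \<gamma> * ((2 + c\<delta>) * (A * (2 * b)))" using kc0 c\<delta> A_ge_1 b by simp
      then show ?thesis using near'[OF u, of x] by (simp add: e_def distrib_right mult.assoc)
    qed
    have nT: "norm (kernel_op M (T u) f x - m x u) \<le> e * (2 * b)" if u: "u > 0" for u x
      using near'[OF u, of x] pert[OF u, of x]
        norm_triangle_ineq[of "kernel_op M (T u) f x - kernel_op M (T' u) f x" "kernel_op M (T' u) f x - m x u"]
      by (simp add: e_def distrib_right mult.assoc)
    have W: "16 * A * (4 * A ^ 3 * (2 * b)) + 12 * A\<^sup>2 * (2 * b)
        + 12 * ((e * (2 * b) + 2 * c * (A * (2 * b))) * subc + 2 * b) + 2 * b = W * (2 * b)"
      by (simp add: W_def algebra_simps power3_eq_cube power4_eq_xxxx)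
    note BT = max_fun_BLO[OF c(2) assms(13) assms(3) nT, unfolded W]
    note BT' = max_fun_BLO[OF c(2) assms(14) assms(3) nT', unfolded W]
    have "ext_BLO_norm M \<rho> (max_fun M T f) + ext_BLO_norm M \<rho> (max_fun M T' f)
        + ext_BLO_norm M \<rho> (local_max_fun M \<rho> T' f) \<le> ennreal (W * (2 * b)) + ennreal (W * (2 * b)) + ennreal (W * (2 * b))"
      by (intro add_mono BT(2) BT'(2) BT'(4))
    also have "\<dots> = ennreal (6 * W * b)"
      using W1 b by (simp flip: ennreal_plus)
    finally show ?thesis using BT(1) BT'(1,3) by blast
  qed
  show ?thesis
  proof (intro exI[of _ "6 * W"] conjI ballI)
    show "6 * W > 0" using W1 by simp
    fix f assume f: "f \<in> BMO M \<rho>"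
    then obtain \<beta> where \<beta>: "BMO_norm M \<rho> f = ennreal \<beta>" "\<beta> \<ge> 0"
      by (cases "BMO_norm M \<rho> f") (auto simp: BMO_def)
    \<comment> \<open>\<open>main\<close> needs a positive bound while the norm may be 0, so it is
      applied slightly above the norm and the excess tends to 0.\<close>
    have le: "BMO_norm M \<rho> f \<le> ennreal (\<beta> + \<epsilon>)" if "\<epsilon> > 0" for \<epsilon>
      using that by (simp add: \<beta> ennreal_leI)
    note main1 = main[OF f le[of 1]]
    show "in_BLO M \<rho> (max_fun M T f)" "in_BLO M \<rho> (max_fun M T' f)" "in_BLO M \<rho> (local_max_fun M \<rho> T' f)"
      using main1 \<beta> by auto
    show "ext_BLO_norm M \<rho> (max_fun M T f) + ext_BLO_norm M \<rho> (max_fun M T' f)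
        + ext_BLO_norm M \<rho> (local_max_fun M \<rho> T' f) \<le> ennreal (6 * W) * BMO_norm M \<rho> f"
    proof (rule ennreal_le_epsilon)
      fix \<epsilon> :: real assume \<epsilon>: "0 < \<epsilon>"
      have d: "\<epsilon> / (6 * W) > 0" using \<epsilon> W1 by simp
      have "ext_BLO_norm M \<rho> (max_fun M T f) + ext_BLO_norm M \<rho> (max_fun M T' f)
        + ext_BLO_norm M \<rho> (local_max_fun M \<rho> T' f) \<le> ennreal (6 * W * (\<beta> + \<epsilon> / (6 * W)))"
        using main[OF f le[OF d]] \<beta>(2) d by simp
      also have "6 * W * (\<beta> + \<epsilon> / (6 * W)) = 6 * W * \<beta> + \<epsilon>"
        using W1 by (simp add: distrib_left)
      also have "ennreal (6 * W * \<beta> + \<epsilon>) = ennreal (6 * W) * BMO_norm M \<rho> f + ennreal \<epsilon>"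
        using W1 \<beta> \<epsilon> by (simp add: ennreal_mult)
      finally show "ext_BLO_norm M \<rho> (max_fun M T f) + ext_BLO_norm M \<rho> (max_fun M T' f)
        + ext_BLO_norm M \<rho> (local_max_fun M \<rho> T' f) \<le> ennreal (6 * W) * BMO_norm M \<rho> f + ennreal \<epsilon>" .
    qed
  qed
qed

end
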